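(* Let $(R,\mathfrak{m})$ be a one-dimensional complete local noetherian integral domain. Then $R$ is $1$-step normal if and only if $\widetilde R$ is isomorphic to $\mathfrak{m}$ as an $R$-module.
   Context: The normalization $\widetilde R$ is the integral closure of $R$ in its fraction field. $R$ is called $1$-step normal if $\widetilde R\cong \operatorname{End}_R(\mathfrak{m})$ (isomorphism of $R$-algebras). *)

theory Defs
  imports "HOL-Algebra.Algebra" "HOL-Library.Extended_Nat"
begin

section \<open>Local rings, dimension, completeness\<close>

definition local_ring :: "('a, 'c) ring_scheme \<Rightarrow> 'a set \<Rightarrow> bool"
  where "local_ring R \<mm> \<longleftrightarrow>
    cring R \<and> maximalideal \<mm> R \<and> (\<forall>J. maximalideal J R \<longrightarrow> J = \<mm>)"

text \<open>Supremum of the lengths \<open>n\<close> of strict chains \<open>P 0 \<subset> \<dots> \<subset> P n\<close> of prime ideals.\<close>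

definition krull_dim :: "('a, 'c) ring_scheme \<Rightarrow> enat"
  where "krull_dim R =
    (SUP n \<in> {n. \<exists>P. (\<forall>i\<le>n. primeideal (P i) R) \<and> (\<forall>i<n. P i \<subset> P (Suc i))}. enat n)"

text \<open>Powers of ideals are powers in the multiplicative monoid of \<open>ideals_set R\<close>, so the
  zeroth power is \<open>carrier R\<close>.\<close>

abbreviation ideal_power :: "('a, 'c) ring_scheme \<Rightarrow> 'a set \<Rightarrow> nat \<Rightarrow> 'a set"
  where "ideal_power R I n \<equiv> I [^]\<^bsub>ideals_set R\<^esub> n"

text \<open>The inverse limit of the rings \<open>R / I\<^sup>n\<close>, as a set. The transition map
  \<open>R / I\<^sup>n\<^sup>+\<^sup>1 \<rightarrow> R / I\<^sup>n\<close> sends a coset to the unique coset containing it, so compatibility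
  of a family of cosets is an inclusion.\<close>

definition adic_limit :: "('a, 'c) ring_scheme \<Rightarrow> 'a set \<Rightarrow> (nat \<Rightarrow> 'a set) set"
  where "adic_limit R I =
    {c. (\<forall>n. c n \<in> carrier (R Quot (ideal_power R I n))) \<and> (\<forall>n. c (Suc n) \<subseteq> c n)}"

text \<open>Bijectivity of the canonical map to the inverse limit; in particular this includes
  separatedness.\<close>

definition adically_complete :: "('a, 'c) ring_scheme \<Rightarrow> 'a set \<Rightarrow> bool"
  where "adically_complete R I \<longleftrightarrow>
    bij_betw (\<lambda>r n. ideal_power R I n +>\<^bsub>R\<^esub> r) (carrier R) (adic_limit R I)"


section \<open>Homomorphisms of modules and algebras\<close>

definition mod_hom ::
    "('a, 'r) ring_scheme \<Rightarrow> ('a, 'b, 'm) module_scheme \<Rightarrow> ('a, 'c, 'n) module_scheme \<Rightarrow> ('b \<Rightarrow> 'c) set"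
  where "mod_hom R M N =
    {f \<in> carrier M \<rightarrow> carrier N.
       (\<forall>x\<in>carrier M. \<forall>y\<in>carrier M. f (x \<oplus>\<^bsub>M\<^esub> y) = f x \<oplus>\<^bsub>N\<^esub> f y) \<and>
       (\<forall>r\<in>carrier R. \<forall>x\<in>carrier M. f (r \<odot>\<^bsub>M\<^esub> x) = r \<odot>\<^bsub>N\<^esub> f x)}"

definition mod_isomorphic ::
    "('a, 'r) ring_scheme \<Rightarrow> ('a, 'b, 'm) module_scheme \<Rightarrow> ('a, 'c, 'n) module_scheme \<Rightarrow> bool"
  where "mod_isomorphic R M N \<longleftrightarrow>
    (\<exists>f \<in> mod_hom R M N. bij_betw f (carrier M) (carrier N))"

definition alg_isomorphic ::
    "('a, 'r) ring_scheme \<Rightarrow> ('a, 'b, 'm) module_scheme \<Rightarrow> ('a, 'c, 'n) module_scheme \<Rightarrow> bool"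
  where "alg_isomorphic R A B \<longleftrightarrow> (\<exists>f \<in> mod_hom R A B. f \<in> ring_iso A B)"

text \<open>Endomorphisms are taken to be \<open>undefined\<close> outside the carrier of \<open>M\<close>, so that each
  endomorphism is represented by exactly one HOL function.\<close>

definition End_algebra ::
    "('a, 'r) ring_scheme \<Rightarrow> ('a, 'b, 'm) module_scheme \<Rightarrow> ('a, 'b \<Rightarrow> 'b) module"
  where "End_algebra R M =
    \<lparr> carrier = mod_hom R M M \<inter> extensional (carrier M),
      monoid.mult = compose (carrier M),
      monoid.one = (\<lambda>x\<in>carrier M. x),
      ring.zero = (\<lambda>x\<in>carrier M. \<zero>\<^bsub>M\<^esub>),
      ring.add = (\<lambda>f g. \<lambda>x\<in>carrier M. f x \<oplus>\<^bsub>M\<^esub> g x),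
      module.smult = (\<lambda>r f. \<lambda>x\<in>carrier M. r \<odot>\<^bsub>M\<^esub> f x) \<rparr>"

text \<open>An ideal regarded as an \<open>R\<close>-module. The fields \<open>mult\<close> and \<open>one\<close> are required by the
  record type but play no role in the module structure.\<close>

definition ideal_module :: "('a, 'r) ring_scheme \<Rightarrow> 'a set \<Rightarrow> ('a, 'a) module"
  where "ideal_module R I =
    \<lparr> carrier = I, monoid.mult = monoid.mult R, monoid.one = \<one>\<^bsub>R\<^esub>,
      ring.zero = \<zero>\<^bsub>R\<^esub>, ring.add = ring.add R, module.smult = monoid.mult R \<rparr>"


section \<open>Fraction field and normalization\<close>

text \<open>\<open>K\<close> is a fraction field of the domain \<open>R\<close> via the embedding \<open>\<iota>\<close>.\<close>

locale fraction_field = R?: domain R + K?: field K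
  for R :: "('a, 'r) ring_scheme" (structure)
    and K :: "('k, 's) ring_scheme" (structure)
    and \<iota> :: "'a \<Rightarrow> 'k" +
  assumes embedding_hom: "\<iota> \<in> ring_hom R K"
    and embedding_inj: "inj_on \<iota> (carrier R)"
    and fractions: "x \<in> carrier K \<Longrightarrow>
      \<exists>a\<in>carrier R. \<exists>b\<in>carrier R - {\<zero>\<^bsub>R\<^esub>}. x = \<iota> a \<otimes>\<^bsub>K\<^esub> inv\<^bsub>K\<^esub> (\<iota> b)"

text \<open>Polynomials are coefficient lists, leading coefficient first, and the zero polynomial is
  \<open>[]\<close>, whose head is unspecified, hence the condition \<open>p \<noteq> []\<close>.\<close>

definition integral_over :: "('k, 's) ring_scheme \<Rightarrow> 'k set \<Rightarrow> 'k \<Rightarrow> bool"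
  where "integral_over K S x \<longleftrightarrow>
    (\<exists>p \<in> carrier (S [X]\<^bsub>K\<^esub>). p \<noteq> [] \<and> lead_coeff p = \<one>\<^bsub>K\<^esub> \<and> ring.eval K p x = \<zero>\<^bsub>K\<^esub>)"

text \<open>The integral closure of \<open>R\<close> in \<open>K\<close>, as an \<open>R\<close>-algebra.\<close>

definition normalization ::
    "('a, 'r) ring_scheme \<Rightarrow> ('k, 's) ring_scheme \<Rightarrow> ('a \<Rightarrow> 'k) \<Rightarrow> ('a, 'k) module"
  where "normalization R K \<iota> =
    \<lparr> carrier = {x \<in> carrier K. integral_over K (\<iota> ` carrier R) x},
      monoid.mult = monoid.mult K, monoid.one = \<one>\<^bsub>K\<^esub>, ring.zero = \<zero>\<^bsub>K\<^esub>, ring.add = ring.add K,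
      module.smult = (\<lambda>r x. \<iota> r \<otimes>\<^bsub>K\<^esub> x) \<rparr>"

text \<open>Here \<open>\<mm>\<close> is the maximal ideal of \<open>R\<close>, and \<open>K\<close> with \<open>\<iota>\<close> a fraction field of \<open>R\<close>.\<close>

definition one_step_normal ::
    "('a, 'r) ring_scheme \<Rightarrow> 'a set \<Rightarrow> ('k, 's) ring_scheme \<Rightarrow> ('a \<Rightarrow> 'k) \<Rightarrow> bool"
  where "one_step_normal R \<mm> K \<iota> \<longleftrightarrow>
    alg_isomorphic R (normalization R K \<iota>) (End_algebra R (ideal_module R \<mm>))"

end

theory Submission
  imports Defs
begin

text \<open>
  Inside \<open>K\<close>, module homomorphisms between \<open>R\<close>-submodules are multiplications by elements of \<open>K\<close>,
  so \<open>R\<close> is 1-step normal iff its integral closure \<open>S\<close> equals \<open>(\<mm> : \<mm>)\<close>, and \<open>S\<close> is isomorphic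
  to \<open>\<mm>\<close> iff \<open>\<mm> = S c\<close> for some \<open>c \<noteq> 0\<close>. If \<open>\<mm> = S c\<close>, then \<open>(\<mm> : \<mm>) = (S : S) = S\<close>. Conversely, if
  \<open>S = (\<mm> : \<mm>)\<close>, then \<open>\<mm>\<close> is an ideal of \<open>S\<close>, and it is invertible: if \<open>\<mm> (S : \<mm>)\<close> were contained
  in a maximal ideal \<open>M\<close>, then every \<open>z \<in> (S : M)\<close> would satisfy \<open>z (S : \<mm>) \<subseteq> (S : \<mm>)\<close> and
  hence be integral over \<open>R\<close>, whereas \<open>(S : M) \<noteq> S\<close> since \<open>S\<close> is one-dimensional.
  An invertible ideal of the semilocal ring \<open>S\<close> is principal; semilocality enters only through the fact that \<open>S / \<mm>\<close> is algebraic over the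
  field \<open>R / \<mm>\<close> and therefore has many idempotents.
\<close>

section \<open>Integral and almost integral elements\<close>

text \<open>The obstacle is that \<open>S\<close> starts out as a bare set of integral elements:
  neither closure under sums nor any finiteness over \<open>A\<close> is at hand. Both come from
  common denominators: over a noetherian \<open>A\<close>, \<open>x\<close> is integral iff some
  nonzero \<open>d\<close> in \<open>A\<close> has \<open>d x^k\<close> in \<open>A\<close> for all
  \<open>k\<close>. Products are then immediate. If \<open>S \<mm> \<subseteq> \<mm>\<close>, sums
  of elements of \<open>S\<close> lie in \<open>(\<mm> : \<mm>)\<close>, hence in \<open>S\<close>,
  and \<open>a S \<subseteq> A\<close> for a nonzero \<open>a\<close> in \<open>\<mm>\<close> makes
  \<open>S\<close> noetherian. Invertibility gives for each maximal ideal \<open>M\<close> above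
  \<open>\<mm>\<close> a product \<open>c z\<close> outside \<open>M\<close>, with \<open>c\<close>
  in \<open>\<mm>\<close> and \<open>z\<close> in \<open>(S : \<mm>)\<close>. The difficulty is to
  find one product avoiding all \<open>M\<close> at once. Two products are merged with weights
  \<open>a\<close> and \<open>1 - a\<close>, where \<open>a = c z\<close> is idempotent modulo
  \<open>\<mm>\<close>, and the maximum condition on ideals of \<open>S\<close> ends the process. A
  single product that is a unit modulo \<open>\<mm>\<close> yields the generator
  \<open>c\<close>.\<close>

text \<open>Negation is left out because scaling by \<open>\<ominus> \<one>\<close> supplies it when
  \<open>B\<close> is a subring. Taking \<open>I\<close> inside the field covers ideals of
  \<open>A\<close>, ideals of \<open>S\<close> and modules such as \<open>poly_values\<close>
  alike.\<close>

definition (in field) stable :: "'a set \<Rightarrow> 'a set \<Rightarrow> bool"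
  where "stable B I \<longleftrightarrow> I \<subseteq> carrier R \<and> \<zero> \<in> I \<and>
    (\<forall>x\<in>I. \<forall>y\<in>I. x \<oplus> y \<in> I) \<and> (\<forall>s\<in>B. \<forall>x\<in>I. s \<otimes> x \<in> I)"

lemma (in field) stableD:
  assumes "stable B I"
  shows "x \<in> I \<Longrightarrow> x \<in> carrier R" "\<zero> \<in> I" "x \<in> I \<Longrightarrow> y \<in> I \<Longrightarrow> x \<oplus> y \<in> I"
    "s \<in> B \<Longrightarrow> x \<in> I \<Longrightarrow> s \<otimes> x \<in> I"
  using assms by (auto simp: stable_def)

lemma (in field) stableI:
  assumes "\<And>x. x \<in> I \<Longrightarrow> x \<in> carrier R" "\<zero> \<in> I" "\<And>x y. x \<in> I \<Longrightarrow> y \<in> I \<Longrightarrow> x \<oplus> y \<in> I"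
    "\<And>s x. s \<in> B \<Longrightarrow> x \<in> I \<Longrightarrow> s \<otimes> x \<in> I"
  shows "stable B I"
  using assms by (auto simp: stable_def)

text \<open>\<open>A\<close> plays the image of the ring in its fraction field, so that no embedding
  intervenes in computations. The maximum condition \<open>acc\<close> is the form of noetherianity
  that transports along multiplication by a nonzero element.\<close>

locale noetherian_fractions = field K for K (structure) +
  fixes A
  assumes subring_A: "subring A K"
    and denominator: "x \<in> carrier K \<Longrightarrow> \<exists>b\<in>A. b \<noteq> \<zero> \<and> b \<otimes> x \<in> A"
    and acc: "\<F> \<noteq> {} \<Longrightarrow> (\<And>I. I \<in> \<F> \<Longrightarrow> stable A I \<and> I \<subseteq> A) \<Longrightarrow>
      \<exists>M\<in>\<F>. \<forall>I\<in>\<F>. M \<subseteq> I \<longrightarrow> I = M"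
begin

lemmas A_simps [simp, intro] = subringE(2,3,5,6,7)[OF subring_A]

lemma A_carrier [simp, intro]: "a \<in> A \<Longrightarrow> a \<in> carrier K"
  using subringE(1)[OF subring_A] by auto

lemma A_minus [simp, intro]: "a \<in> A \<Longrightarrow> b \<in> A \<Longrightarrow> a \<ominus> b \<in> A"
  by (simp add: a_minus_def)

lemma A_pow [simp, intro]: "a \<in> A \<Longrightarrow> a [^] (n::nat) \<in> A"
  by (induction n) auto

lemma pow_nonzero: "a \<in> carrier K \<Longrightarrow> a \<noteq> \<zero> \<Longrightarrow> a [^] (n::nat) \<noteq> \<zero>"
  by (induction n) (auto simp: integral_iff)

lemma cancel_left: "a \<in> carrier K \<Longrightarrow> a \<noteq> \<zero> \<Longrightarrow> x \<in> carrier K \<Longrightarrow> y \<in> carrier K \<Longrightarrow>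
  a \<otimes> x = a \<otimes> y \<longleftrightarrow> x = y"
  using m_lcancel by auto

text \<open>The \<open>A\<close>-module spanned by \<open>1, x, ..., x^(n-1)\<close>. Unlike
  normalized polynomials, the lists may begin with zeros, so a fixed length merely bounds the
  degree.\<close>

definition poly_values :: "'a \<Rightarrow> nat \<Rightarrow> 'a set"
  where "poly_values x n = {eval q x | q. set q \<subseteq> A \<and> length q = n}"

lemma poly_values_0: "poly_values x 0 = {\<zero>}"
  by (auto simp: poly_values_def)

lemma poly_values_Suc:
  "poly_values x (Suc n) = {c \<otimes> x [^] n \<oplus> w | c w. c \<in> A \<and> w \<in> poly_values x n}" (is "?l = ?r")
proof
  show "?l \<subseteq> ?r"
    by (fastforce simp: poly_values_def length_Suc_conv)
  show "?r \<subseteq> ?l"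
  proof
    fix y assume "y \<in> ?r"
    then obtain c q where "c \<in> A" "set q \<subseteq> A" "length q = n" "y = c \<otimes> x [^] n \<oplus> eval q x"
      by (auto simp: poly_values_def)
    then show "y \<in> ?l"
      by (auto simp: poly_values_def intro!: exI[of _ "c # q"])
  qed
qed

lemma poly_values_SucI:
  "c \<in> A \<Longrightarrow> w \<in> poly_values x n \<Longrightarrow> c \<otimes> x [^] n \<oplus> w \<in> poly_values x (Suc n)"
  by (auto simp: poly_values_Suc)

lemma poly_values_stable:
  assumes x: "x \<in> carrier K"
  shows "stable A (poly_values x n)"
proof (induction n)
  case 0
  then show ?case by (auto simp: stable_def poly_values_0)
next
  case (Suc n)
  note IH = Suc[unfolded stable_def]
  have c: "w \<in> carrier K" if "w \<in> poly_values x n" for w using IH that by auto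
  show ?case unfolding stable_def
  proof (intro conjI ballI subsetI)
    show "y \<in> carrier K" if "y \<in> poly_values x (Suc n)" for y
      using that x c by (auto simp: poly_values_Suc)
    have "\<zero> = \<zero> \<otimes> x [^] n \<oplus> \<zero>" using x by simp
    then show "\<zero> \<in> poly_values x (Suc n)"
      using IH poly_values_SucI[of \<zero> \<zero> x n] by simp
    fix y assume "y \<in> poly_values x (Suc n)"
    then obtain a v where y: "a \<in> A" "v \<in> poly_values x n" "y = a \<otimes> x [^] n \<oplus> v"
      by (auto simp: poly_values_Suc)
    {
      fix z assume "z \<in> poly_values x (Suc n)"
      then obtain b w where z: "b \<in> A" "w \<in> poly_values x n" "z = b \<otimes> x [^] n \<oplus> w"
        by (auto simp: poly_values_Suc)
      have "y \<oplus> z = (a \<oplus> b) \<otimes> x [^] n \<oplus> (v \<oplus> w)"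
        unfolding y z using x y(1) z(1) c[OF y(2)] c[OF z(2)]
        by (simp add: l_distr a_ac)
      then show "y \<oplus> z \<in> poly_values x (Suc n)"
        using y z IH by (simp add: poly_values_SucI)
    }
    fix s assume s: "s \<in> A"
    have "s \<otimes> y = (s \<otimes> a) \<otimes> x [^] n \<oplus> s \<otimes> v"
      unfolding y using x s y(1) c[OF y(2)] by (simp add: r_distr m_assoc)
    then show "s \<otimes> y \<in> poly_values x (Suc n)"
      using y s IH by (simp add: poly_values_SucI)
  qed
qed

lemma poly_values_carrier: "x \<in> carrier K \<Longrightarrow> w \<in> poly_values x n \<Longrightarrow> w \<in> carrier K"
  using stableD(1)[OF poly_values_stable] .

lemma poly_values_mono:
  assumes x: "x \<in> carrier K" and w: "w \<in> poly_values x n" and le: "n \<le> k"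
  shows "w \<in> poly_values x k"
  using le
proof (induction k rule: dec_induct)
  case base
  then show ?case by (rule w)
next
  case (step k)
  have "w \<in> carrier K" using poly_values_carrier[OF x w] .
  then have "w = \<zero> \<otimes> x [^] k \<oplus> w" using x by simp
  then show ?case using step poly_values_SucI[of \<zero> w x k] by simp
qed

lemma poly_values_mult:
  assumes x: "x \<in> carrier K" and w: "w \<in> poly_values x n"
  shows "x \<otimes> w \<in> poly_values x (Suc n)"
  using w
proof (induction n arbitrary: w)
  case 0
  then have "x \<otimes> w = \<zero>" using x by (simp add: poly_values_0)
  then show ?case using poly_values_stable[OF x] by (simp add: stable_def)
next
  case (Suc n)
  from Suc.prems obtain c v where v: "c \<in> A" "v \<in> poly_values x n" "w = c \<otimes> x [^] n \<oplus> v"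
    by (auto simp: poly_values_Suc)
  have "v \<in> carrier K" using v poly_values_carrier[OF x] by auto
  then have "x \<otimes> w = c \<otimes> x [^] Suc n \<oplus> x \<otimes> v"
    unfolding v(3) using x v(1) by (simp add: r_distr m_ac)
  then show ?case using poly_values_SucI[OF v(1) Suc.IH[OF v(2)]] by simp
qed

text \<open>Moving the leading term of a monic equation to the other side leaves a combination of
  lower powers; the sign is absorbed because that module is stable under
  \<open>\<ominus> \<one>\<close>.\<close>

lemma integral_over_iff:
  assumes x: "x \<in> carrier K"
  shows "integral_over K A x \<longleftrightarrow> (\<exists>n. x [^] n \<in> poly_values x n)"
proof
  assume "integral_over K A x"
  then obtain p where p: "p \<in> carrier (A [X])" "p \<noteq> []" "hd p = \<one>" "eval p x = \<zero>"
    by (auto simp: integral_over_def)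
  then obtain q where q: "p = \<one> # q" by (cases p) auto
  have qA: "set q \<subseteq> A" using p q by (auto simp: univ_poly_def polynomial_def)
  then have c: "eval q x \<in> carrier K" using x by (intro eval_in_carrier) auto
  have "x [^] length q \<oplus> eval q x = \<zero>" using p(4) x by (simp add: q)
  then have "x [^] length q = \<ominus> \<one> \<otimes> eval q x"
    using x c minus_equality by (simp add: l_minus)
  moreover have "eval q x \<in> poly_values x (length q)" using qA by (auto simp: poly_values_def)
  ultimately show "\<exists>n. x [^] n \<in> poly_values x n"
    using stableD(4)[OF poly_values_stable[OF x], of "\<ominus> \<one>"] by (intro exI[of _ "length q"]) simp
next
  assume "\<exists>n. x [^] n \<in> poly_values x n"
  then obtain n where n: "x [^] n \<in> poly_values x n" by auto
  then have "\<ominus> \<one> \<otimes> (x [^] n) \<in> poly_values x n"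
    using stableD(4)[OF poly_values_stable[OF x]] by simp
  then obtain q where q: "set q \<subseteq> A" "length q = n" "\<ominus> \<one> \<otimes> (x [^] n) = eval q x"
    by (auto simp: poly_values_def)
  have "eval (\<one> # q) x = \<zero>"
    using q x by (simp add: q(3)[symmetric] l_minus r_neg)
  moreover have "\<one> # q \<in> carrier (A [X])"
    using q by (auto simp: univ_poly_def polynomial_def)
  ultimately show "integral_over K A x"
    unfolding integral_over_def by (intro bexI[of _ "\<one> # q"]) auto
qed

lemma poly_values_denominator:
  assumes x: "x \<in> carrier K" and b: "b \<in> A" "b \<otimes> x \<in> A" and w: "w \<in> poly_values x n"
  shows "b [^] n \<otimes> w \<in> A"
  using w
proof (induction n arbitrary: w)
  case 0
  then show ?case using b by (simp add: poly_values_0)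
next
  case (Suc n)
  from Suc.prems obtain c v where v: "c \<in> A" "v \<in> poly_values x n" "w = c \<otimes> x [^] n \<oplus> v"
    by (auto simp: poly_values_Suc)
  have vc: "v \<in> carrier K" using v poly_values_carrier[OF x] by auto
  have "b [^] Suc n \<otimes> w = b \<otimes> c \<otimes> (b \<otimes> x) [^] n \<oplus> b \<otimes> (b [^] n \<otimes> v)"
    unfolding v(3) using x v(1) vc b(1)
    by (simp add: r_distr nat_pow_distrib m_ac)
  also have "\<dots> \<in> A" using b v Suc.IH[OF v(2)] by auto
  finally show ?case .
qed

text \<open>A monic equation of degree \<open>n\<close> makes the module of lower powers closed
  under multiplication by \<open>x\<close>. It therefore contains all powers, and \<open>b^n\<close>
  clears the entire module once \<open>b\<close> clears \<open>x\<close>.\<close>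

lemma integral_imp_almost_integral:
  assumes x: "x \<in> carrier K" and int: "integral_over K A x"
  shows "\<exists>d\<in>A. d \<noteq> \<zero> \<and> (\<forall>k::nat. d \<otimes> x [^] k \<in> A)"
proof -
  obtain n where n: "x [^] n \<in> poly_values x n" using int integral_over_iff[OF x] by auto
  obtain b where b: "b \<in> A" "b \<noteq> \<zero>" "b \<otimes> x \<in> A" using denominator[OF x] by auto
  have st: "stable A (poly_values x n)" by (rule poly_values_stable[OF x])
  \<comment> \<open>For \<open>n = 0\<close> the module is zero; a positive \<open>n\<close> puts
    \<open>\<one>\<close>, the start of the induction on powers, into it.\<close>
  have n0: "n \<noteq> 0" using n by (intro notI) (simp add: poly_values_0)
  have step: "x \<otimes> w \<in> poly_values x n" if w: "w \<in> poly_values x n" for w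
  proof -
    obtain c v where v: "c \<in> A" "v \<in> poly_values x n" "x \<otimes> w = c \<otimes> x [^] n \<oplus> v"
      using poly_values_mult[OF x w] by (auto simp: poly_values_Suc)
    then show ?thesis using st n by (auto simp: stable_def)
  qed
  have "\<one> = \<one> \<otimes> x [^] (0::nat) \<oplus> \<zero>" using x by simp
  then have "\<one> \<in> poly_values x (Suc 0)"
    using poly_values_SucI[of \<one> \<zero> x 0] by (simp add: poly_values_0)
  then have one: "\<one> \<in> poly_values x n" using poly_values_mono[OF x] n0 by simp
  have "x [^] (k::nat) \<in> poly_values x n" for k
  proof (induction k)
    case (Suc k)
    then show ?case using step[OF Suc] x by (simp add: m_comm)
  qed (use one in simp)
  then have "b [^] n \<otimes> x [^] k \<in> A" for k :: nat
    using poly_values_denominator[OF x b(1,3)] by blast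
  moreover have "b [^] n \<noteq> \<zero>" using b by (intro pow_nonzero) auto
  ultimately show ?thesis using b by (intro bexI[of _ "b [^] n"]) auto
qed

lemma stable_scale:
  assumes I: "stable B I" and B: "B \<subseteq> carrier K" and d: "d \<in> carrier K"
  shows "stable B ((\<otimes>) d ` I)"
proof (rule stableI)
  show "\<zero> \<in> (\<otimes>) d ` I" using stableD(2)[OF I] d by force
  fix x assume "x \<in> (\<otimes>) d ` I"
  then obtain u where u: "u \<in> I" "x = d \<otimes> u" by auto
  have uc: "u \<in> carrier K" using stableD(1)[OF I u(1)] .
  then show "x \<in> carrier K" using u d by simp
  show "s \<otimes> x \<in> (\<otimes>) d ` I" if "s \<in> B" for s
  proof -
    have "s \<otimes> x = d \<otimes> (s \<otimes> u)" unfolding u using that B uc d by (simp add: m_lcomm subset_iff)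
    then show ?thesis using stableD(4)[OF I that u(1)] by simp
  qed
  fix y assume "y \<in> (\<otimes>) d ` I"
  then obtain v where v: "v \<in> I" "y = d \<otimes> v" by auto
  have "x \<oplus> y = d \<otimes> (u \<oplus> v)"
    unfolding u v using uc stableD(1)[OF I v(1)] d by (simp add: r_distr)
  then show "x \<oplus> y \<in> (\<otimes>) d ` I" using stableD(3)[OF I u(1) v(1)] by simp
qed

text \<open>The ideals \<open>d (A + A x + ... + A x^(n-1))\<close> of \<open>A\<close> ascend with
  \<open>n\<close>. Where they become stationary, cancelling \<open>d\<close> puts
  \<open>x^n\<close> among the combinations of lower powers.\<close>

lemma almost_integral_imp_integral:
  assumes x: "x \<in> carrier K" and d: "d \<in> A" "d \<noteq> \<zero>" "\<And>k::nat. d \<otimes> x [^] k \<in> A"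
  shows "integral_over K A x"
proof -
  define I where "I n = (\<otimes>) d ` poly_values x n" for n
  have pc: "poly_values x n \<subseteq> carrier K" for n using poly_values_stable[OF x] by (simp add: stable_def)
  have "d \<otimes> w \<in> A" if "w \<in> poly_values x n" for w n
    using that
  proof (induction n arbitrary: w)
    case 0
    then show ?case using d by (simp add: poly_values_0)
  next
    case (Suc n)
    from Suc.prems obtain c v where v: "c \<in> A" "v \<in> poly_values x n" "w = c \<otimes> x [^] n \<oplus> v"
      by (auto simp: poly_values_Suc)
    have "v \<in> carrier K" using v pc by auto
    then have "d \<otimes> w = c \<otimes> (d \<otimes> x [^] n) \<oplus> d \<otimes> v"
      unfolding v(3) using x v(1) d(1) by (simp add: r_distr m_ac)
    also have "\<dots> \<in> A" using v d(3) Suc.IH by auto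
    finally show ?case .
  qed
  then have sub: "I n \<subseteq> A" for n by (auto simp: I_def)
  have st: "stable A (I n)" for n
    unfolding I_def by (intro stable_scale poly_values_stable x) (use d in auto)
  have "\<exists>M\<in>range I. \<forall>J\<in>range I. M \<subseteq> J \<longrightarrow> J = M"
    by (rule acc) (use sub st in auto)
  then obtain n where n: "\<forall>k. I n \<subseteq> I k \<longrightarrow> I k = I n" by auto
  have "I n \<subseteq> I (Suc n)" using poly_values_mono[OF x, of _ n "Suc n"] by (auto simp: I_def)
  then have eq: "I (Suc n) = I n" using n by blast
  have "x [^] n = \<one> \<otimes> x [^] n \<oplus> \<zero>" using x by simp
  then have "x [^] n \<in> poly_values x (Suc n)"
    using poly_values_SucI[of \<one> \<zero> x n] poly_values_stable[OF x] by (simp add: stable_def)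
  then have "d \<otimes> x [^] n \<in> I n" using eq by (auto simp: I_def)
  then obtain w where "w \<in> poly_values x n" "d \<otimes> x [^] n = d \<otimes> w" by (auto simp: I_def)
  then have "x [^] n \<in> poly_values x n"
    using cancel_left[of d "x [^] n" w] d x pc[of n] by auto
  then show ?thesis using integral_over_iff[OF x] by auto
qed

definition integral_closure :: "'a set"
  where "integral_closure = {x \<in> carrier K. integral_over K A x}"

lemma integral_closure_iff:
  "x \<in> integral_closure \<longleftrightarrow>
    x \<in> carrier K \<and> (\<exists>d\<in>A. d \<noteq> \<zero> \<and> (\<forall>k::nat. d \<otimes> x [^] k \<in> A))"
  unfolding integral_closure_def mem_Collect_eq
  using integral_imp_almost_integral almost_integral_imp_integral by blast

lemma integral_closure_mult:
  assumes "x \<in> integral_closure" "y \<in> integral_closure"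
  shows "x \<otimes> y \<in> integral_closure"
proof -
  obtain d e where d: "d \<in> A" "d \<noteq> \<zero>" "\<And>k::nat. d \<otimes> x [^] k \<in> A"
    and e: "e \<in> A" "e \<noteq> \<zero>" "\<And>k::nat. e \<otimes> y [^] k \<in> A"
    and c: "x \<in> carrier K" "y \<in> carrier K"
    using assms by (auto simp: integral_closure_iff)
  have "(d \<otimes> e) \<otimes> (x \<otimes> y) [^] k = (d \<otimes> x [^] k) \<otimes> (e \<otimes> y [^] k)" for k :: nat
    using c d(1) e(1) by (simp add: nat_pow_distrib m_ac)
  then have "(d \<otimes> e) \<otimes> (x \<otimes> y) [^] k \<in> A" for k :: nat using d(3) e(3) by simp
  moreover have "d \<otimes> e \<noteq> \<zero>" using d e by (auto simp: integral_iff)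
  ultimately show ?thesis unfolding integral_closure_iff using c d e by blast
qed

lemma subset_integral_closure: "A \<subseteq> integral_closure"
proof
  fix a assume "a \<in> A"
  then show "a \<in> integral_closure"
    unfolding integral_closure_iff by (intro conjI bexI[of _ \<one>] allI) auto
qed

end

section \<open>One-dimensional local rings\<close>

text \<open>Dimension one is encoded by \<open>m_nonzero\<close> and \<open>power_dvd\<close>; the
  latter says that every element of \<open>\<mm>\<close> is nilpotent modulo any nonzero
  \<open>a\<close> in \<open>\<mm>\<close>.\<close>

locale one_dim_local_fractions = noetherian_fractions +
  fixes \<mm>
  assumes m_stable: "stable A \<mm>"
    and m_subset: "\<mm> \<subseteq> A"
    and one_notin_m: "\<one> \<notin> \<mm>"
    and unit_if_notin_m: "a \<in> A \<Longrightarrow> a \<notin> \<mm> \<Longrightarrow> \<exists>b\<in>A. a \<otimes> b = \<one>"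
    and m_nonzero: "\<exists>a\<in>\<mm>. a \<noteq> \<zero>"
    and power_dvd: "a \<in> \<mm> \<Longrightarrow> a \<noteq> \<zero> \<Longrightarrow> y \<in> \<mm> \<Longrightarrow> \<exists>n::nat. \<exists>c\<in>A. y [^] n = a \<otimes> c"
begin

lemma m_A [simp]: "x \<in> \<mm> \<Longrightarrow> x \<in> A"
  using m_subset by auto

text \<open>A nonzero \<open>a\<close> in \<open>\<mm>\<close> is a common denominator for all
  powers of \<open>w\<close>, as \<open>a w^k\<close> never leaves \<open>\<mm>\<close>. This is
  \<open>(\<mm> : \<mm>) \<subseteq> S\<close>.\<close>

lemma colon_subset_integral_closure:
  assumes w: "w \<in> carrier K" and mult: "\<And>y. y \<in> \<mm> \<Longrightarrow> w \<otimes> y \<in> \<mm>"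
  shows "w \<in> integral_closure"
proof -
  obtain a where a: "a \<in> \<mm>" "a \<noteq> \<zero>" using m_nonzero by auto
  have "a \<otimes> w [^] k \<in> \<mm>" for k :: nat
  proof (induction k)
    case (Suc k)
    have "a \<otimes> w [^] Suc k = w \<otimes> (a \<otimes> w [^] k)" using a w by (simp add: m_ac)
    then show ?case using mult[OF Suc] by simp
  qed (use a in auto)
  then have "\<forall>k::nat. a \<otimes> w [^] k \<in> A" by simp
  then show ?thesis unfolding integral_closure_iff using a w m_A[OF a(1)] by blast
qed

end

section \<open>Ring structure of the integral closure when
  \<open>S \<mm> \<subseteq> \<mm>\<close>\<close>

locale one_step_normal_fractions = one_dim_local_fractions +
  assumes integral_closure_m: "s \<in> integral_closure \<Longrightarrow> y \<in> \<mm> \<Longrightarrow> s \<otimes> y \<in> \<mm>"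
begin

abbreviation S where "S \<equiv> integral_closure"

lemma S_carrier [simp]: "x \<in> S \<Longrightarrow> x \<in> carrier K"
  by (simp add: integral_closure_def)

lemma A_S [simp]: "x \<in> A \<Longrightarrow> x \<in> S"
  using subset_integral_closure by auto

lemma S_add [simp]: "x \<in> S \<Longrightarrow> y \<in> S \<Longrightarrow> x \<oplus> y \<in> S"
  by (rule colon_subset_integral_closure)
    (auto simp: l_distr integral_closure_m intro: stableD(3)[OF m_stable])

lemma S_mult [simp]: "x \<in> S \<Longrightarrow> y \<in> S \<Longrightarrow> x \<otimes> y \<in> S"
  by (rule integral_closure_mult)

lemma S_uminus [simp]: "x \<in> S \<Longrightarrow> \<ominus> x \<in> S"
  using S_mult[of "\<ominus> \<one>" x] by (simp add: l_minus)

lemma S_minus [simp]: "x \<in> S \<Longrightarrow> y \<in> S \<Longrightarrow> x \<ominus> y \<in> S"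
  by (simp add: a_minus_def)

lemma S_pow [simp]: "x \<in> S \<Longrightarrow> x [^] (n::nat) \<in> S"
  by (induction n) auto

lemma S_subset: "S \<subseteq> carrier K" by auto

lemma stable_S_m: "stable S \<mm>"
  by (rule stableI) (auto intro: stableD(2,3)[OF m_stable] integral_closure_m)

lemma stable_S_S: "stable S S"
  by (rule stableI) auto

lemma stable_uminus: "stable S I \<Longrightarrow> x \<in> I \<Longrightarrow> \<ominus> x \<in> I"
  using stableD(4)[of S I "\<ominus> \<one>" x] stableD(1)[of S I x] by (simp add: l_minus)

lemma stable_minus: "stable S I \<Longrightarrow> x \<in> I \<Longrightarrow> y \<in> I \<Longrightarrow> x \<ominus> y \<in> I"
  by (simp add: a_minus_def stable_uminus stableD(3))

text \<open>Multiplication by a nonzero \<open>a\<close> in \<open>\<mm>\<close> maps ideals of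
  \<open>S\<close> injectively to ideals of \<open>A\<close>, because
  \<open>a S \<subseteq> \<mm>\<close>; a maximal member is pulled back along it.\<close>

lemma S_acc:
  assumes ne: "\<F> \<noteq> {}" and F: "\<And>I. I \<in> \<F> \<Longrightarrow> stable S I \<and> I \<subseteq> S"
  shows "\<exists>M\<in>\<F>. \<forall>I\<in>\<F>. M \<subseteq> I \<longrightarrow> I = M"
proof -
  obtain a where a: "a \<in> \<mm>" "a \<noteq> \<zero>" using m_nonzero by auto
  have inj: "inj_on ((\<otimes>) a) S"
    by (rule inj_onI) (use a cancel_left[of a] in auto)
  have "\<exists>M\<in>(`) ((\<otimes>) a) ` \<F>. \<forall>I\<in>(`) ((\<otimes>) a) ` \<F>. M \<subseteq> I \<longrightarrow> I = M"
  proof (rule acc)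
    fix J assume "J \<in> (`) ((\<otimes>) a) ` \<F>"
    then obtain I where I: "I \<in> \<F>" "J = (\<otimes>) a ` I" by auto
    have "stable S J" unfolding I by (rule stable_scale) (use F[OF I(1)] a S_subset in auto)
    moreover have "J \<subseteq> A"
    proof
      fix x assume "x \<in> J"
      then obtain s where s: "s \<in> S" "x = a \<otimes> s" using I F by auto
      then have "x = s \<otimes> a" using a by (simp add: m_comm)
      then show "x \<in> A" using integral_closure_m[OF s(1) a(1)] by auto
    qed
    ultimately show "stable A J \<and> J \<subseteq> A" using A_S by (auto simp: stable_def)
  qed (use ne in auto)
  then obtain M where M: "M \<in> \<F>" "\<forall>I\<in>\<F>. (\<otimes>) a ` M \<subseteq> (\<otimes>) a ` I \<longrightarrow> (\<otimes>) a ` I = (\<otimes>) a ` M"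
    by auto
  have "I = M" if I: "I \<in> \<F>" "M \<subseteq> I" for I
  proof -
    have "(\<otimes>) a ` I = (\<otimes>) a ` M" using M(2) I by (meson image_mono)
    then show ?thesis
      using inj_on_image_eq_iff[OF inj, of I M] F[OF I(1)] F[OF M(1)] by auto
  qed
  then show ?thesis using M(1) by auto
qed

section \<open>Algebraicity and idempotents modulo \<open>\<mm>\<close>\<close>

lemma eval_snoc:
  "set q \<subseteq> carrier K \<Longrightarrow> c \<in> carrier K \<Longrightarrow> x \<in> carrier K \<Longrightarrow>
    eval (q @ [c]) x = eval q x \<otimes> x \<oplus> c"
  by (induction q) (auto simp: l_distr m_assoc a_assoc eval_in_carrier)

lemma eval_S: "set q \<subseteq> A \<Longrightarrow> x \<in> S \<Longrightarrow> eval q x \<in> S"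
  by (induction q) auto

text \<open>Modulo \<open>\<mm>\<close>, the coefficients of a polynomial below its lowest unit coefficient vanish.\<close>

lemma eval_mod_m:
  assumes x: "x \<in> S"
  shows "set p \<subseteq> A \<Longrightarrow> \<not> set p \<subseteq> \<mm> \<Longrightarrow>
    \<exists>u n h \<mu>. u \<in> A - \<mm> \<and> h \<in> S \<and> \<mu> \<in> \<mm> \<and> eval p x = u \<otimes> (x [^] (n::nat) \<otimes> (\<one> \<ominus> x \<otimes> h)) \<oplus> \<mu>"
proof (induction p rule: rev_induct)
  case (snoc c q)
  let ?e = "eval q x"
  have q: "set q \<subseteq> A" "c \<in> A" using snoc.prems by auto
  have e: "?e \<in> S" using eval_S q x by auto
  have ev: "eval (q @ [c]) x = ?e \<otimes> x \<oplus> c" using q x by (intro eval_snoc) auto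
  show ?case
  proof (cases "c \<in> \<mm>")
    case False
    then obtain b where b: "b \<in> A" "c \<otimes> b = \<one>" using unit_if_notin_m q by auto
    \<comment> \<open>A unit constant term stops the recursion:
      \<open>e x + c = c (1 + x b e)\<close>, which is exponent 0 with \<open>h = - b e\<close> and
      no remainder.\<close>
    have "c \<otimes> (x [^] (0::nat) \<otimes> (\<one> \<ominus> x \<otimes> \<ominus> (b \<otimes> ?e))) \<oplus> \<zero> = c \<oplus> x \<otimes> (c \<otimes> b) \<otimes> ?e"
      using x e A_carrier[OF q(2)] A_carrier[OF b(1)] S_carrier[OF x] S_carrier[OF e]
      unfolding nat_pow_0 by algebra
    also have "\<dots> = ?e \<otimes> x \<oplus> c" using b q x e by (simp add: m_comm a_comm)
    finally have "?e \<otimes> x \<oplus> c = c \<otimes> (x [^] (0::nat) \<otimes> (\<one> \<ominus> x \<otimes> \<ominus> (b \<otimes> ?e))) \<oplus> \<zero>" ..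
    moreover have "c \<in> A - \<mm>" "\<ominus> (b \<otimes> ?e) \<in> S" "\<zero> \<in> \<mm>"
      using False q b e stableD(2)[OF m_stable] by simp_all
    ultimately show ?thesis unfolding ev by blast
  next
    case True
    then have "\<not> set q \<subseteq> \<mm>" using snoc.prems by auto
    then obtain u n h \<mu> where *: "u \<in> A - \<mm>" "h \<in> S" "\<mu> \<in> \<mm>"
      "?e = u \<otimes> (x [^] (n::nat) \<otimes> (\<one> \<ominus> x \<otimes> h)) \<oplus> \<mu>"
      using snoc.IH q by auto
    \<comment> \<open>A constant term in \<open>\<mm>\<close> joins the remainder, and the exponent
      of \<open>x\<close> grows by one.\<close>
    have "?e \<otimes> x \<oplus> c = u \<otimes> (x [^] n \<otimes> x \<otimes> (\<one> \<ominus> x \<otimes> h)) \<oplus> (x \<otimes> \<mu> \<oplus> c)"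
    proof -
      have "u \<in> carrier K" "x \<in> carrier K" "h \<in> carrier K" "\<mu> \<in> carrier K" "c \<in> carrier K"
        "x [^] n \<in> carrier K" using x * q by auto
      then show ?thesis unfolding *(4) by algebra
    qed
    moreover have "x \<otimes> \<mu> \<oplus> c \<in> \<mm>"
      using stableD(3,4)[OF stable_S_m] x * True by blast
    ultimately show ?thesis unfolding ev using *(1,2)
      by (intro exI[of _ u] exI[of _ "Suc n"] exI[of _ h] exI[of _ "x \<otimes> \<mu> \<oplus> c"]) auto
  qed
qed simp

text \<open>A monic equation of \<open>x\<close> has a coefficient outside \<open>\<mm>\<close>, so
  \<open>eval_mod_m\<close> factors it, and the unit \<open>u\<close> is divided out. In
  \<open>S / \<mm>\<close> the result reads \<open>x^n = x^(n+1) h\<close>.\<close>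

lemma pi_regular_mod_m:
  assumes x: "x \<in> S"
  shows "\<exists>n h. h \<in> S \<and> x [^] (n::nat) \<otimes> (\<one> \<ominus> x \<otimes> h) \<in> \<mm>"
proof -
  obtain p where p: "p \<in> carrier (A [X])" "p \<noteq> []" "hd p = \<one>" "eval p x = \<zero>"
    using x unfolding integral_closure_def mem_Collect_eq integral_over_def by blast
  have pA: "set p \<subseteq> A" using p(1,2) by (simp add: univ_poly_def polynomial_def)
  have "\<not> set p \<subseteq> \<mm>" using p one_notin_m hd_in_set[of p] by auto
  then obtain u n h \<mu> where *: "u \<in> A - \<mm>" "h \<in> S" "\<mu> \<in> \<mm>"
    "\<zero> = u \<otimes> (x [^] (n::nat) \<otimes> (\<one> \<ominus> x \<otimes> h)) \<oplus> \<mu>"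
    using eval_mod_m[OF x pA] p(4) by auto
  obtain b where b: "b \<in> A" "u \<otimes> b = \<one>" using unit_if_notin_m * by auto
  let ?y = "x [^] n \<otimes> (\<one> \<ominus> x \<otimes> h)"
  have c: "?y \<in> carrier K" "\<mu> \<in> carrier K" "u \<in> carrier K" "b \<in> carrier K" using x * b by auto
  have "?y = (u \<otimes> b) \<otimes> ?y" using b c by simp
  also have "\<dots> = b \<otimes> (u \<otimes> ?y \<oplus> \<mu>) \<ominus> b \<otimes> \<mu>"
    using c by algebra
  also have "\<dots> = \<ominus> b \<otimes> \<mu>" using c unfolding *(4)[symmetric] by algebra
  also have "\<dots> \<in> \<mm>" using stableD(4)[OF m_stable, of "\<ominus> b" \<mu>] b * by auto
  finally show ?thesis using * by auto
qed

text \<open>Iterating \<open>x^n = x^(n+1) h\<close> gives \<open>x^(n+1) = x^(n+1) (x h)^j\<close>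
  modulo \<open>\<mm>\<close>, so \<open>(x h)^(n+1)\<close> is idempotent there. It is written
  \<open>x g\<close> to exhibit it as a multiple of \<open>x\<close>; the last clause makes it
  congruent to 1 modulo every prime above \<open>\<mm>\<close> that omits \<open>x\<close>.\<close>

lemma idempotent_mod_m:
  assumes x: "x \<in> S"
  shows "\<exists>g\<in>S. x \<otimes> g \<otimes> (\<one> \<ominus> x \<otimes> g) \<in> \<mm> \<and> (\<exists>n::nat. x [^] n \<otimes> (\<one> \<ominus> x \<otimes> g) \<in> \<mm>)"
proof -
  obtain n :: nat and h where h: "h \<in> S" "x [^] n \<otimes> (\<one> \<ominus> x \<otimes> h) \<in> \<mm>"
    using pi_regular_mod_m[OF x] by auto
  let ?y = "x [^] Suc n" and ?z = "x \<otimes> h"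
  have c: "x \<in> carrier K" "h \<in> carrier K" "?y \<in> carrier K" "?z \<in> carrier K" "x [^] n \<in> carrier K"
    using x h by auto
  have "?y \<otimes> (\<one> \<ominus> ?z) = x \<otimes> (x [^] n \<otimes> (\<one> \<ominus> ?z))" using c by (simp add: m_ac)
  then have y: "?y \<otimes> (\<one> \<ominus> ?z) \<in> \<mm>" using integral_closure_m[OF x h(2)] by simp
  have main: "?y \<otimes> (\<one> \<ominus> ?z [^] j) \<in> \<mm>" for j :: nat
  proof (induction j)
    case 0
    have "?y \<otimes> (\<one> \<ominus> ?z [^] (0::nat)) = \<zero>" using c unfolding nat_pow_0 by algebra
    then show ?case using stableD(2)[OF m_stable] by simp
  next
    case (Suc j)
    have "?z [^] j \<in> carrier K" using c by auto
    \<comment> \<open>Telescoping: \<open>1 - z^(j+1) = (1 - z^j) + z^j (1 - z)\<close>.\<close>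
    then have "?y \<otimes> (\<one> \<ominus> ?z [^] j \<otimes> ?z) =
        ?y \<otimes> (\<one> \<ominus> ?z [^] j) \<oplus> ?z [^] j \<otimes> (?y \<otimes> (\<one> \<ominus> ?z))"
      using c(3,4) by algebra
    then show ?case using Suc y x h
      by (auto intro!: stableD(3)[OF m_stable] integral_closure_m)
  qed
  define g where "g = x [^] n \<otimes> h [^] Suc n"
  have g: "g \<in> S" using x h by (auto simp: g_def)
  have e: "x \<otimes> g = ?z [^] Suc n" "x \<otimes> g = h [^] Suc n \<otimes> ?y"
    using c by (simp_all add: g_def nat_pow_distrib m_ac)
  have gc: "x \<otimes> g \<in> carrier K" using c g by auto
  have 1: "?y \<otimes> (\<one> \<ominus> x \<otimes> g) \<in> \<mm>" using main[of "Suc n"] e(1) by simp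
  have "x \<otimes> g \<otimes> (\<one> \<ominus> x \<otimes> g) = h [^] Suc n \<otimes> (?y \<otimes> (\<one> \<ominus> x \<otimes> g))"
    using gc c e(2) by (metis m_assoc minus_closed nat_pow_closed one_closed)
  also have "\<dots> \<in> \<mm>" using integral_closure_m[OF S_pow[OF h(1)] 1] .
  finally show ?thesis using 1 g by blast
qed

end

section \<open>Principality of the maximal ideal\<close>

context one_step_normal_fractions
begin

section \<open>Maximal ideals of \<open>S\<close> above \<open>\<mm>\<close>, and the inverse of
  \<open>\<mm>\<close>\<close>

definition maximal_above_m :: "'a set \<Rightarrow> bool"
  where "maximal_above_m M \<longleftrightarrow> stable S M \<and> M \<subseteq> S \<and> \<mm> \<subseteq> M \<and> \<one> \<notin> M \<and>
    (\<forall>I. stable S I \<longrightarrow> I \<subseteq> S \<longrightarrow> M \<subseteq> I \<longrightarrow> \<one> \<notin> I \<longrightarrow> I = M)"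

lemma exists_maximal_above_m:
  assumes Q: "stable S Q" "Q \<subseteq> S" "\<mm> \<subseteq> Q" "\<one> \<notin> Q"
  shows "\<exists>M. maximal_above_m M \<and> Q \<subseteq> M"
proof -
  let ?F = "{I. stable S I \<and> I \<subseteq> S \<and> Q \<subseteq> I \<and> \<one> \<notin> I}"
  have "\<exists>M\<in>?F. \<forall>I\<in>?F. M \<subseteq> I \<longrightarrow> I = M"
    by (rule S_acc) (use Q in auto)
  then obtain M where M: "M \<in> ?F" "\<forall>I\<in>?F. M \<subseteq> I \<longrightarrow> I = M" by auto
  have "maximal_above_m M" unfolding maximal_above_m_def
  proof (intro conjI allI impI)
    fix I assume "stable S I" "I \<subseteq> S" "M \<subseteq> I" "\<one> \<notin> I"
    moreover from this have "Q \<subseteq> I" using M(1) by blast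
    ultimately show "I = M" using M(2) by blast
  qed (use M Q in auto)
  then show ?thesis using M by auto
qed

lemma stable_adjoin:
  assumes M: "stable S M" and x: "x \<in> S"
  shows "stable S {\<mu> \<oplus> x \<otimes> s | \<mu> s. \<mu> \<in> M \<and> s \<in> S}" (is "stable S ?I")
proof (rule stableI)
  note Mc = stableD(1)[OF M]
  show "y \<in> carrier K" if "y \<in> ?I" for y using that x Mc by auto
  have "\<zero> = \<zero> \<oplus> x \<otimes> \<zero>" "\<zero> \<in> M" "\<zero> \<in> S" using x stableD(2)[OF M] by simp_all
  then show "\<zero> \<in> ?I" by blast
  fix y assume "y \<in> ?I"
  then obtain \<mu> s where y: "\<mu> \<in> M" "s \<in> S" "y = \<mu> \<oplus> x \<otimes> s" by auto
  have yc: "\<mu> \<in> carrier K" "s \<in> carrier K" "x \<in> carrier K" using y x Mc by auto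
  show "t \<otimes> y \<in> ?I" if t: "t \<in> S" for t
  proof -
    have "t \<otimes> y = t \<otimes> \<mu> \<oplus> x \<otimes> (t \<otimes> s)"
      unfolding y using S_carrier[OF t] yc by algebra
    moreover have "t \<otimes> \<mu> \<in> M" "t \<otimes> s \<in> S" using stableD(4)[OF M t] y t by simp_all
    ultimately show ?thesis by blast
  qed
  fix z assume "z \<in> ?I"
  then obtain \<nu> t where z: "\<nu> \<in> M" "t \<in> S" "z = \<nu> \<oplus> x \<otimes> t" by auto
  have "y \<oplus> z = (\<mu> \<oplus> \<nu>) \<oplus> x \<otimes> (s \<oplus> t)"
    unfolding y z using yc S_carrier[OF z(2)] Mc[OF z(1)] by algebra
  moreover have "\<mu> \<oplus> \<nu> \<in> M" "s \<oplus> t \<in> S" using stableD(3)[OF M] y z by simp_all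
  ultimately show "y \<oplus> z \<in> ?I" by blast
qed

text \<open>The fractional ideal \<open>(S : \<mm>)\<close>, the candidate for the inverse of
  \<open>\<mm>\<close>.\<close>

definition colon_m :: "'a set"
  where "colon_m = {z \<in> carrier K. \<forall>y\<in>\<mm>. z \<otimes> y \<in> S}"

context
  fixes M
  assumes M: "maximal_above_m M"
begin

lemma M_stable: "stable S M" and M_S: "x \<in> M \<Longrightarrow> x \<in> S" and m_M: "x \<in> \<mm> \<Longrightarrow> x \<in> M"
  and one_notin_M: "\<one> \<notin> M"
  using M by (auto simp: maximal_above_m_def)

text \<open>Since \<open>x\<close> is outside \<open>M\<close>, maximality gives
  \<open>1 = \<mu> + x s\<close>; multiplying by \<open>y\<close> expresses \<open>y\<close> through
  \<open>\<mu>\<close> and \<open>x y\<close>.\<close>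

lemma M_prime:
  assumes x: "x \<in> S" and y: "y \<in> S" and xy: "x \<otimes> y \<in> M" and xM: "x \<notin> M"
  shows "y \<in> M"
proof -
  let ?I = "{\<mu> \<oplus> x \<otimes> s | \<mu> s. \<mu> \<in> M \<and> s \<in> S}"
  have "stable S ?I" by (rule stable_adjoin[OF M_stable x])
  moreover have "?I \<subseteq> S" using x M_S by auto
  moreover have "M \<subseteq> ?I"
  proof
    fix \<mu> assume \<mu>: "\<mu> \<in> M"
    have "\<mu> = \<mu> \<oplus> x \<otimes> \<zero>" "\<zero> \<in> S" using S_carrier[OF M_S[OF \<mu>]] x by simp_all
    then show "\<mu> \<in> ?I" using \<mu> by blast
  qed
  moreover have "x \<in> ?I"
  proof -
    have "x = \<zero> \<oplus> x \<otimes> \<one>" "\<zero> \<in> M" "\<one> \<in> S" using x stableD(2)[OF M_stable] by simp_all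
    then show ?thesis by blast
  qed
  then have "?I \<noteq> M" using xM by blast
  ultimately have "\<one> \<in> ?I" using M unfolding maximal_above_m_def by blast
  then obtain \<mu> s where *: "\<mu> \<in> M" "s \<in> S" "\<one> = \<mu> \<oplus> x \<otimes> s" by auto
  have c: "x \<in> carrier K" "y \<in> carrier K" "s \<in> carrier K" "\<mu> \<in> carrier K"
    using x y * M_S S_carrier by blast+
  have "y = (\<mu> \<oplus> x \<otimes> s) \<otimes> y" using c unfolding *(3)[symmetric] by simp
  also have "\<dots> = y \<otimes> \<mu> \<oplus> s \<otimes> (x \<otimes> y)" using c by algebra
  also have "\<dots> \<in> M"
    using stableD(3,4)[OF M_stable] y * xy by blast
  finally show ?thesis .
qed

lemma M_prime_pow: "x \<in> S \<Longrightarrow> x [^] (n::nat) \<in> M \<Longrightarrow> x \<in> M"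
proof (induction n)
  case 0
  then show ?case using one_notin_M by simp
next
  case (Suc n)
  then show ?case using M_prime[of "x [^] n" x] by auto
qed

text \<open>The conductor ideals \<open>(a S : b)\<close> contained in \<open>M\<close> have a maximal member, which equals
  \<open>M\<close> because \<open>S / a S\<close> is zero-dimensional; then \<open>b / a\<close> is the required element.\<close>

lemma inverse_of_maximal_nontrivial: "\<exists>z\<in>carrier K. z \<notin> S \<and> (\<forall>y\<in>M. z \<otimes> y \<in> S)"
proof -
  obtain a where a: "a \<in> \<mm>" "a \<noteq> \<zero>" using m_nonzero by auto
  have ac: "a \<in> carrier K" "a \<in> S" using a by simp_all
  define aS where "aS = (\<otimes>) a ` S"
  have aS: "stable S aS" unfolding aS_def by (rule stable_scale[OF stable_S_S S_subset ac(1)])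
  \<comment> \<open>\<open>C b\<close> is the annihilator of \<open>b\<close> in
    \<open>S / a S\<close>; a \<open>b\<close> is sought for which it is exactly
    \<open>M\<close>.\<close>
  define C where "C b = {s \<in> S. s \<otimes> b \<in> aS}" for b
  have C: "stable S (C b)" if b: "b \<in> S" for b
  proof (rule stableI)
    show "\<zero> \<in> C b" using b stableD(2)[OF aS] by (simp add: C_def)
    fix x assume "x \<in> C b"
    then have x: "x \<in> S" "x \<otimes> b \<in> aS" by (auto simp: C_def)
    show "x \<in> carrier K" using x by simp
    show "s \<otimes> x \<in> C b" if "s \<in> S" for s
      using stableD(4)[OF aS that x(2)] that x b by (simp add: C_def m_assoc)
    fix y assume "y \<in> C b"
    then have y: "y \<in> S" "y \<otimes> b \<in> aS" by (auto simp: C_def)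
    show "x \<oplus> y \<in> C b" using x y b stableD(3)[OF aS x(2) y(2)] by (simp add: C_def l_distr)
  qed
  let ?F = "{I. \<exists>b\<in>S. I = C b \<and> C b \<subseteq> M}"
  have "aS \<subseteq> \<mm>"
    unfolding aS_def using integral_closure_m[OF _ a(1)] ac by (auto simp: m_comm)
  then have "C \<one> \<subseteq> M" using m_M by (auto simp: C_def)
  then have "C \<one> \<in> ?F" by auto
  \<comment> \<open>Here \<open>colon_m\<close> is a bound variable ranging over the family,
    unrelated to the fractional ideal of that name.\<close>
  then have "\<exists>I\<in>?F. \<forall>colon_m\<in>?F. I \<subseteq> colon_m \<longrightarrow> colon_m = I"
    by (intro S_acc) (use C in \<open>auto simp: C_def\<close>)
  then obtain I where I: "I \<in> ?F" "\<And>L. L \<in> ?F \<Longrightarrow> I \<subseteq> L \<Longrightarrow> L = I" by meson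
  then obtain b where b: "b \<in> S" "C b \<subseteq> M" and Cb: "I = C b" by blast
  have max: "C d = C b" if "d \<in> S" "C d \<subseteq> M" "C b \<subseteq> C d" for d
    using I(2)[of "C d"] that Cb by blast
  have mult: "C b \<subseteq> C (x \<otimes> b)" if x: "x \<in> S" for x
  proof
    fix s assume s: "s \<in> C b"
    then have "s \<in> S" "s \<otimes> b \<in> aS" by (auto simp: C_def)
    moreover from this have "s \<otimes> (x \<otimes> b) = x \<otimes> (s \<otimes> b)" using x b by (simp add: m_lcomm)
    ultimately show "s \<in> C (x \<otimes> b)" using stableD(4)[OF aS x] by (simp add: C_def)
  qed
  have MC: "x \<in> C b" if xM: "x \<in> M" for x
  proof (cases "C (x \<otimes> b) \<subseteq> M")
    \<comment> \<open>By maximality \<open>x b\<close> has the same annihilator as \<open>b\<close>,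
      so \<open>x\<close> can be cancelled modulo \<open>C b\<close>. As
      \<open>x^n (1 - x h)\<close> is nilpotent modulo \<open>a S\<close>, cancelling the powers of
      \<open>x\<close> leaves \<open>1 - x h\<close> nilpotent modulo \<open>C b\<close>, hence in
      the prime \<open>M\<close>; this is impossible for \<open>x\<close> in
      \<open>M\<close>.\<close>
    case True
    have x: "x \<in> S" using M_S[OF xM] .
    have eq: "C (x \<otimes> b) = C b" using max[OF _ True mult[OF x]] x b by simp
    have cancel: "y \<in> C b" if y: "y \<in> S" "x \<otimes> y \<in> C b" for y
    proof -
      have "x \<otimes> y \<otimes> b = y \<otimes> (x \<otimes> b)" using x y b by (simp add: m_ac)
      then have "y \<in> C (x \<otimes> b)" using y by (simp add: C_def)
      then show ?thesis using eq by simp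
    qed
    have cancel_pow: "y \<in> C b" if y: "y \<in> S" "x [^] k \<otimes> y \<in> C b" for y and k :: nat
      using y(2)
    proof (induction k)
      case 0
      then show ?case using y by simp
    next
      case (Suc k)
      have "x [^] Suc k \<otimes> y = x \<otimes> (x [^] k \<otimes> y)" using x y by (simp add: m_ac)
      then have "x [^] k \<otimes> y \<in> C b" using Suc.prems cancel[of "x [^] k \<otimes> y"] x y by simp
      then show ?case by (rule Suc.IH)
    qed
    obtain n h where h: "h \<in> S" "x [^] (n::nat) \<otimes> (\<one> \<ominus> x \<otimes> h) \<in> \<mm>"
      using pi_regular_mod_m[OF x] by auto
    let ?u = "\<one> \<ominus> x \<otimes> h"
    have u: "?u \<in> S" using x h by simp
    obtain N c where N: "c \<in> A" "(x [^] n \<otimes> ?u) [^] (N::nat) = a \<otimes> c"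
      using power_dvd[OF a h(2)] by auto
    have "(x [^] n \<otimes> ?u) [^] N = x [^] (n * N) \<otimes> ?u [^] N"
      using S_carrier[OF u] S_carrier[OF x] by (simp add: nat_pow_distrib nat_pow_pow)
    moreover have "a \<otimes> c \<in> aS" using N by (auto simp: aS_def)
    ultimately have "x [^] (n * N) \<otimes> ?u [^] N \<in> aS" using N by simp
    moreover have "aS \<subseteq> C b"
    proof
      fix s assume s: "s \<in> aS"
      then have sS: "s \<in> S" using ac by (auto simp: aS_def)
      then have "s \<otimes> b = b \<otimes> s" using b by (simp add: m_comm)
      then show "s \<in> C b" using stableD(4)[OF aS b(1) s] sS by (simp add: C_def)
    qed
    ultimately have "?u [^] N \<in> C b" using cancel_pow[OF S_pow[OF u]] by blast
    then have "?u [^] N \<in> M" using b by blast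
    then have uM: "?u \<in> M" using M_prime_pow[OF u] by simp
    have "h \<otimes> x \<in> M" using stableD(4)[OF M_stable h(1) xM] .
    then have "?u \<oplus> h \<otimes> x \<in> M" using stableD(3)[OF M_stable uM] by simp
    moreover have "?u \<oplus> h \<otimes> x = \<one>" using S_carrier[OF x] S_carrier[OF h(1)] by algebra
    ultimately show ?thesis using one_notin_M by simp
  next
    \<comment> \<open>Some \<open>s\<close> outside \<open>M\<close> annihilates \<open>x b\<close>
      modulo \<open>a S\<close>. Since \<open>M\<close> is prime, \<open>C (s b)\<close> stays
      inside \<open>M\<close>, so it equals \<open>C b\<close> by maximality, and it contains
      \<open>x\<close>.\<close>
    case False
    have x: "x \<in> S" using M_S[OF xM] .
    obtain s where s: "s \<in> S" "s \<otimes> (x \<otimes> b) \<in> aS" "s \<notin> M" using False by (auto simp: C_def)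
    have "C (s \<otimes> b) \<subseteq> M"
    proof
      fix y assume "y \<in> C (s \<otimes> b)"
      then have y: "y \<in> S" "y \<otimes> (s \<otimes> b) \<in> aS" by (auto simp: C_def)
      have "y \<otimes> (s \<otimes> b) = s \<otimes> y \<otimes> b" using y s b by (simp add: m_ac)
      then have "s \<otimes> y \<in> C b" using y s by (simp add: C_def)
      then have "s \<otimes> y \<in> M" using b by auto
      then show "y \<in> M" using M_prime[OF s(1) y(1)] s(3) by blast
    qed
    then have eq: "C (s \<otimes> b) = C b" using max[OF _ _ mult[OF s(1)]] s b by simp
    have "s \<otimes> (x \<otimes> b) = x \<otimes> (s \<otimes> b)" using x s b by (simp add: m_lcomm)
    then have "x \<in> C (s \<otimes> b)" using s x by (simp add: C_def)
    then show ?thesis using eq by simp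
  qed
  define z where "z = inv a \<otimes> b"
  have ia: "inv a \<in> carrier K" "a \<otimes> inv a = \<one>" "inv a \<otimes> a = \<one>"
    using a ac field_Units by auto
  have zc: "z \<in> carrier K" using ia b by (simp add: z_def)
  have "z \<notin> S"
  proof
    assume z: "z \<in> S"
    have "a \<otimes> z = (a \<otimes> inv a) \<otimes> b" unfolding z_def using ac b ia(1) by (simp add: m_assoc)
    then have "a \<otimes> z = b" using ia b by simp
    then have "\<one> \<in> C b" using z b by (auto simp: C_def aS_def)
    then show False using b one_notin_M by auto
  qed
  moreover have "z \<otimes> y \<in> S" if y: "y \<in> M" for y
  proof -
    have "y \<otimes> b \<in> aS" using MC[OF y] by (simp add: C_def)
    then obtain s where s: "s \<in> S" "y \<otimes> b = a \<otimes> s" by (auto simp: aS_def)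
    have "z \<otimes> y = inv a \<otimes> (y \<otimes> b)" unfolding z_def using ia b M_S[OF y] by (simp add: m_ac)
    also have "\<dots> = (inv a \<otimes> a) \<otimes> s" unfolding s using ia(1) ac s by (simp add: m_assoc)
    also have "\<dots> = s" using ia s by simp
    finally show ?thesis using s by simp
  qed
  ultimately show ?thesis using zc by blast
qed

lemma exists_product_notin_maximal: "\<exists>c\<in>\<mm>. \<exists>z\<in>colon_m. c \<otimes> z \<notin> M"
proof (rule ccontr)
  assume neg: "\<not> ?thesis"
  obtain z where z: "z \<in> carrier K" "z \<notin> S" "\<And>y. y \<in> M \<Longrightarrow> z \<otimes> y \<in> S"
    using inverse_of_maximal_nontrivial by auto
  obtain a where a: "a \<in> \<mm>" "a \<noteq> \<zero>" using m_nonzero by auto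
  have "z [^] k \<in> colon_m" for k :: nat
  proof (induction k)
    case 0
    then show ?case by (simp add: colon_m_def)
  next
    case (Suc k)
    have "z [^] Suc k \<otimes> y \<in> S" if y: "y \<in> \<mm>" for y
    proof -
      have "z \<otimes> (y \<otimes> z [^] k) \<in> S" using z(3) neg y Suc by blast
      moreover have "z \<otimes> (y \<otimes> z [^] k) = z [^] Suc k \<otimes> y" using z(1) y by (simp add: m_ac)
      ultimately show ?thesis by simp
    qed
    then show ?case using z(1) by (simp add: colon_m_def)
  qed
  then have k: "z [^] k \<otimes> a \<in> S" for k :: nat using a by (simp add: colon_m_def)
  \<comment> \<open>One factor \<open>a\<close> moves \<open>z^k\<close> into \<open>S\<close>, the
    second moves the result into \<open>\<mm>\<close>, which lies in \<open>A\<close>.\<close>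
  have "a \<otimes> a \<otimes> z [^] k \<in> A" for k :: nat
  proof -
    have "a \<otimes> a \<otimes> z [^] k = (z [^] k \<otimes> a) \<otimes> a" using a z(1) by (simp add: m_ac)
    then show ?thesis using integral_closure_m[OF k a(1)] by simp
  qed
  moreover have "a \<otimes> a \<noteq> \<zero>" using a by (simp add: integral_iff)
  ultimately have "z \<in> S"
    unfolding integral_closure_iff using z(1) a(1) by (intro conjI bexI[of _ "a \<otimes> a"]) simp_all
  then show False using z by simp
qed

end

section \<open>Gluing products from \<open>\<mm>\<close> and \<open>(S : \<mm>)\<close>\<close>

lemma colon_m_S: "z \<in> colon_m \<Longrightarrow> s \<in> S \<Longrightarrow> s \<otimes> z \<in> colon_m"
  by (simp add: colon_m_def m_assoc)

lemma colon_m_add: "z \<in> colon_m \<Longrightarrow> z' \<in> colon_m \<Longrightarrow> z \<oplus> z' \<in> colon_m"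
  by (simp add: colon_m_def l_distr)

lemma colon_m_m: "c \<in> \<mm> \<Longrightarrow> z \<in> colon_m \<Longrightarrow> c \<otimes> z \<in> S"
  using m_A[of c] by (auto simp: colon_m_def m_comm[of c z])

text \<open>\<open>q\<close> is the join of \<open>a\<close> and \<open>e\<close>, since
  \<open>1 - q = (1 - a) (1 - e)\<close>. Its defect \<open>q (1 - q)\<close> is therefore a
  combination of the defects of \<open>a\<close> and \<open>e\<close>, and the perturbation
  \<open>\<mu>\<close> contributes only a multiple of itself.\<close>

lemma glued_idempotent:
  assumes a: "a \<in> carrier K" and e: "e \<in> carrier K" and \<mu>: "\<mu> \<in> carrier K"
  defines "q \<equiv> a \<oplus> e \<ominus> a \<otimes> e"
  shows "(q \<oplus> \<mu>) \<otimes> (\<one> \<ominus> (q \<oplus> \<mu>)) =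
    (\<one> \<ominus> e) \<otimes> (a \<otimes> (\<one> \<ominus> a)) \<oplus> ((\<one> \<ominus> a) \<otimes> (\<one> \<ominus> a)) \<otimes> (e \<otimes> (\<one> \<ominus> e))
    \<oplus> (\<one> \<ominus> q \<ominus> q \<ominus> \<mu>) \<otimes> \<mu>"
proof -
  have q: "q \<in> carrier K" using a e by (simp add: q_def)
  have "(q \<oplus> \<mu>) \<otimes> (\<one> \<ominus> (q \<oplus> \<mu>)) = q \<otimes> (\<one> \<ominus> q) \<oplus> (\<one> \<ominus> q \<ominus> q \<ominus> \<mu>) \<otimes> \<mu>"
    using q \<mu> by algebra
  moreover have "q \<otimes> (\<one> \<ominus> q) =
    (\<one> \<ominus> e) \<otimes> (a \<otimes> (\<one> \<ominus> a)) \<oplus> ((\<one> \<ominus> a) \<otimes> (\<one> \<ominus> a)) \<otimes> (e \<otimes> (\<one> \<ominus> e))"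
  proof -
    define f g where "f = \<one> \<ominus> a" and "g = \<one> \<ominus> e"
    have fg: "f \<in> carrier K" "g \<in> carrier K" using a e by (simp_all add: f_def g_def)
    have "\<one> \<ominus> q = f \<otimes> g" "q = a \<oplus> e \<otimes> f"
      unfolding q_def f_def g_def using a e by algebra+
    moreover have "(a \<oplus> e \<otimes> f) \<otimes> (f \<otimes> g) = g \<otimes> (a \<otimes> f) \<oplus> (f \<otimes> f) \<otimes> (e \<otimes> g)"
      using a e fg by algebra
    ultimately show ?thesis unfolding f_def g_def by simp
  qed
  ultimately show ?thesis by simp
qed

text \<open>Giving \<open>(c, z)\<close> the weight \<open>a\<close> and \<open>(d, v)\<close> the
  weight \<open>1 - a\<close> produces \<open>a^3 + (1 - a)^2 e\<close> plus cross terms. Modulo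
  \<open>a (1 - a)\<close> the weights are orthogonal idempotents, so the cross terms vanish and
  \<open>a + (1 - a) e\<close> remains.\<close>

lemma glued_product:
  assumes "c \<in> carrier K" "d \<in> carrier K" "z \<in> carrier K" "v \<in> carrier K"
  defines "a \<equiv> c \<otimes> z" and "e \<equiv> d \<otimes> v"
  shows "(a \<otimes> c \<oplus> (\<one> \<ominus> a) \<otimes> d) \<otimes> (a \<otimes> z \<oplus> (\<one> \<ominus> a) \<otimes> v) =
    (a \<oplus> e \<ominus> a \<otimes> e) \<oplus> (c \<otimes> v \<oplus> d \<otimes> z \<ominus> a \<ominus> e \<ominus> \<one>) \<otimes> (a \<otimes> (\<one> \<ominus> a))"
proof -
  define f x m where "f = \<one> \<ominus> a" and "x = c \<otimes> v \<oplus> d \<otimes> z" and "m = a \<otimes> f"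
  have ae: "a \<in> carrier K" "e \<in> carrier K" "f \<in> carrier K" "x \<in> carrier K" "m \<in> carrier K"
    using assms by (simp_all add: f_def x_def m_def)
  have "(a \<otimes> c \<oplus> f \<otimes> d) \<otimes> (a \<otimes> z \<oplus> f \<otimes> v) =
      a \<otimes> a \<otimes> (c \<otimes> z) \<oplus> f \<otimes> f \<otimes> (d \<otimes> v) \<oplus> a \<otimes> f \<otimes> (c \<otimes> v \<oplus> d \<otimes> z)"
    using assms(1-4) ae(1,3) by algebra
  then have *: "(a \<otimes> c \<oplus> f \<otimes> d) \<otimes> (a \<otimes> z \<oplus> f \<otimes> v) = a \<otimes> a \<otimes> a \<oplus> f \<otimes> f \<otimes> e \<oplus> m \<otimes> x"
    by (simp add: a_def e_def x_def m_def)
  have "a \<otimes> a = a \<ominus> m" "f \<otimes> f = f \<ominus> m"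
    using ae unfolding m_def f_def by algebra+
  moreover have "(a \<ominus> m) \<otimes> a = a \<ominus> m \<ominus> m \<otimes> a"
    using \<open>a \<otimes> a = a \<ominus> m\<close> ae by algebra
  ultimately have "a \<otimes> a \<otimes> a \<oplus> f \<otimes> f \<otimes> e \<oplus> m \<otimes> x =
      (a \<ominus> m \<ominus> m \<otimes> a) \<oplus> (f \<ominus> m) \<otimes> e \<oplus> m \<otimes> x" by simp
  also have "\<dots> = (a \<oplus> f \<otimes> e) \<oplus> (x \<ominus> a \<ominus> e \<ominus> \<one>) \<otimes> m"
    using ae by algebra
  also have "f \<otimes> e = e \<ominus> a \<otimes> e" unfolding f_def using ae by algebra
  also have "a \<oplus> (e \<ominus> a \<otimes> e) = a \<oplus> e \<ominus> a \<otimes> e" using ae by algebra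
  finally show ?thesis using * by (simp add: f_def x_def m_def)
qed

text \<open>Gluing along idempotents modulo \<open>\<mm>\<close> replaces the Chinese remainder theorem for the
  finitely many maximal ideals of \<open>S\<close>.\<close>

lemma exists_product_unit_mod_m: "\<exists>c\<in>\<mm>. \<exists>z\<in>colon_m. \<exists>t\<in>S. \<exists>\<mu>\<in>\<mm>. \<one> = \<mu> \<oplus> c \<otimes> z \<otimes> t"
proof -
  define Q where "Q x = {\<mu> \<oplus> x \<otimes> s | \<mu> s. \<mu> \<in> \<mm> \<and> s \<in> S}" for x
  have Q: "stable S (Q x)" "Q x \<subseteq> S" "\<mm> \<subseteq> Q x" if x: "x \<in> S" for x
  proof -
    show "stable S (Q x)" unfolding Q_def by (rule stable_adjoin[OF stable_S_m x])
    show "Q x \<subseteq> S" unfolding Q_def using x by auto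
    show "\<mm> \<subseteq> Q x"
    proof
      fix \<mu> assume \<mu>: "\<mu> \<in> \<mm>"
      have "\<mu> = \<mu> \<oplus> x \<otimes> \<zero>" "\<zero> \<in> S" using \<mu> x by simp_all
      then show "\<mu> \<in> Q x" using \<mu> unfolding Q_def by blast
    qed
  qed
  have QI: "\<mu> \<oplus> x \<otimes> s \<in> Q x" if "\<mu> \<in> \<mm>" "s \<in> S" for \<mu> x s
    using that by (auto simp: Q_def)
  define P where "P c z \<longleftrightarrow> c \<in> \<mm> \<and> z \<in> colon_m \<and> c \<otimes> z \<otimes> (\<one> \<ominus> c \<otimes> z) \<in> \<mm>" for c z
  let ?F = "{Q (c \<otimes> z) | c z. P c z}"
  \<comment> \<open>The zero product starts the family; \<open>\<one>\<close> belongs to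
    \<open>colon_m\<close> because \<open>\<mm> \<subseteq> S\<close>.\<close>
  have "P \<zero> \<one>" using stableD(2)[OF stable_S_m] by (simp add: P_def colon_m_def)
  then have "?F \<noteq> {}" by blast
  moreover have "stable S I \<and> I \<subseteq> S" if "I \<in> ?F" for I
  proof -
    obtain c z where cz: "I = Q (c \<otimes> z)" "P c z" using \<open>I \<in> ?F\<close> by blast
    then have "c \<otimes> z \<in> S" using colon_m_m by (simp add: P_def)
    then show ?thesis using Q cz by simp
  qed
  ultimately have "\<exists>I\<in>?F. \<forall>L\<in>?F. I \<subseteq> L \<longrightarrow> L = I" by (rule S_acc)
  then obtain I where I: "I \<in> ?F" "\<And>L. L \<in> ?F \<Longrightarrow> I \<subseteq> L \<Longrightarrow> L = I" by meson
  then obtain c z where cz: "P c z" and Icz: "I = Q (c \<otimes> z)" by blast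
  have max: "Q (c' \<otimes> z') = Q (c \<otimes> z)" if "P c' z'" "Q (c \<otimes> z) \<subseteq> Q (c' \<otimes> z')" for c' z'
    using I(2)[of "Q (c' \<otimes> z')"] that Icz by blast
  let ?a = "c \<otimes> z"
  have cz': "c \<in> \<mm>" "z \<in> colon_m" "?a \<otimes> (\<one> \<ominus> ?a) \<in> \<mm>" using cz by (auto simp: P_def)
  have aS: "?a \<in> S" using colon_m_m cz' by simp
  have "\<one> \<in> Q ?a"
  proof (rule ccontr)
    assume "\<one> \<notin> Q ?a"
    then obtain M where M: "maximal_above_m M" "Q ?a \<subseteq> M"
      using exists_maximal_above_m Q[OF aS] by blast
    obtain d w where d: "d \<in> \<mm>" "w \<in> colon_m" "d \<otimes> w \<notin> M"
      using exists_product_notin_maximal[OF M(1)] by auto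
    let ?b = "d \<otimes> w"
    have bS: "?b \<in> S" using colon_m_m d by simp
    \<comment> \<open>Scaling by \<open>g\<close> turns \<open>d w\<close> into an element
      \<open>e\<close> that is idempotent modulo \<open>\<mm>\<close> and, as \<open>d w\<close> is
      outside \<open>M\<close>, congruent to 1 modulo \<open>M\<close>.\<close>
    obtain g n where g: "g \<in> S" "?b \<otimes> g \<otimes> (\<one> \<ominus> ?b \<otimes> g) \<in> \<mm>"
      "?b [^] (n::nat) \<otimes> (\<one> \<ominus> ?b \<otimes> g) \<in> \<mm>"
      using idempotent_mod_m[OF bS] by blast
    let ?e = "?b \<otimes> g"
    have eS: "?e \<in> S" using bS g by simp
    have "?b [^] n \<notin> M" using M_prime_pow[OF M(1) bS] d by blast
    then have e1: "\<one> \<ominus> ?e \<in> M"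
      using M_prime[OF M(1) S_pow[OF bS] _ m_M[OF M(1) g(3)]] eS by simp
    have eM: "?e \<notin> M"
    proof
      assume "?e \<in> M"
      then have "(\<one> \<ominus> ?e) \<oplus> ?e \<in> M" using stableD(3)[OF M_stable[OF M(1)] e1] by simp
      moreover have "(\<one> \<ominus> ?e) \<oplus> ?e = \<one>" using S_carrier[OF eS] by algebra
      ultimately show False using one_notin_M[OF M(1)] by simp
    qed
    define c' where "c' = ?a \<otimes> c \<oplus> (\<one> \<ominus> ?a) \<otimes> d"
    define z' where "z' = ?a \<otimes> z \<oplus> (\<one> \<ominus> ?a) \<otimes> (g \<otimes> w)"
    have gw: "g \<otimes> w \<in> colon_m" using colon_m_S d g by simp
    have c': "c' \<in> \<mm>" unfolding c'_def
      using stableD(3,4)[OF stable_S_m] aS cz' d by simp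
    have z': "z' \<in> colon_m" unfolding z'_def
      using colon_m_add colon_m_S aS cz' gw by simp
    have dgw: "d \<otimes> (g \<otimes> w) = ?e" using d g by (simp add: colon_m_def m_ac)
    have cc: "c \<in> carrier K" "d \<in> carrier K" "z \<in> carrier K" "w \<in> carrier K" "g \<in> carrier K"
      using cz' d g by (auto simp: colon_m_def)
    define q where "q = ?a \<oplus> ?e \<ominus> ?a \<otimes> ?e"
    define m1 where "m1 = ?a \<otimes> (\<one> \<ominus> ?a)"
    have "\<exists>\<mu>\<in>\<mm>. c' \<otimes> z' = q \<oplus> \<mu>"
    proof -
      define \<mu> where "\<mu> = (c \<otimes> (g \<otimes> w) \<oplus> d \<otimes> z \<ominus> ?a \<ominus> ?e \<ominus> \<one>) \<otimes> m1"
      have "c \<otimes> (g \<otimes> w) \<in> S" "d \<otimes> z \<in> S" using colon_m_m cz' d gw by simp_all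
      then have "\<mu> \<in> \<mm>" unfolding \<mu>_def using cz' aS eS
        by (simp add: m1_def integral_closure_m)
      moreover have "c' \<otimes> z' = q \<oplus> \<mu>"
        unfolding c'_def z'_def q_def \<mu>_def m1_def dgw[symmetric]
        by (rule glued_product) (use cc in simp_all)
      ultimately show ?thesis by blast
    qed
    then obtain \<mu> where \<mu>: "\<mu> \<in> \<mm>" "c' \<otimes> z' = q \<oplus> \<mu>" by auto
    have qS: "q \<in> S" using aS eS by (simp add: q_def)
    have carr: "?a \<in> carrier K" "?e \<in> carrier K" "\<mu> \<in> carrier K" "q \<in> carrier K"
      using aS eS \<mu> qS by simp_all
    have "P c' z'"
    proof -
      have "(q \<oplus> \<mu>) \<otimes> (\<one> \<ominus> (q \<oplus> \<mu>)) =
        (\<one> \<ominus> ?e) \<otimes> (?a \<otimes> (\<one> \<ominus> ?a)) \<oplus> ((\<one> \<ominus> ?a) \<otimes> (\<one> \<ominus> ?a)) \<otimes> (?e \<otimes> (\<one> \<ominus> ?e))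
        \<oplus> (\<one> \<ominus> q \<ominus> q \<ominus> \<mu>) \<otimes> \<mu>"
        unfolding q_def by (rule glued_idempotent) (use carr in simp_all)
      also have "\<dots> \<in> \<mm>"
        using cz'(3) g(2) \<mu>(1) aS eS qS m_A[OF \<mu>(1)]
        by (simp add: stableD(3)[OF stable_S_m] integral_closure_m)
      finally show ?thesis using c' z' \<mu>(2) by (simp add: P_def)
    qed
    have *: "\<nu> \<oplus> (q \<oplus> \<mu>) \<otimes> s \<in> Q (c' \<otimes> z')" if "\<nu> \<in> \<mm>" "s \<in> S" for \<nu> s
      using QI that \<mu>(2) by simp
    have QQ: "stable S (Q (c' \<otimes> z'))" using Q colon_m_m c' z' by simp
    have "?a \<in> Q (c' \<otimes> z')"
    proof -
      \<comment> \<open>The exact identity \<open>a = (1 - e) a (1 - a) + q a\<close> makes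
        \<open>a\<close> a multiple of \<open>q\<close> up to \<open>\<mm>\<close>; the term
        \<open>a \<mu>\<close> adjusts it to \<open>q + \<mu>\<close>.\<close>
      let ?\<nu> = "(\<one> \<ominus> ?e) \<otimes> (?a \<otimes> (\<one> \<ominus> ?a)) \<ominus> ?a \<otimes> \<mu>"
      have "?\<nu> \<in> \<mm>" using stable_minus[OF stable_S_m] integral_closure_m aS eS cz'(3) \<mu>(1) by simp
      moreover have "?\<nu> \<oplus> (q \<oplus> \<mu>) \<otimes> ?a = ?a"
        unfolding q_def using carr(1,2,3) by algebra
      ultimately show ?thesis using *[of ?\<nu> ?a] aS by simp
    qed
    have "Q ?a \<subseteq> Q (c' \<otimes> z')"
    proof
      fix y assume "y \<in> Q ?a"
      then obtain \<nu> s where y: "\<nu> \<in> \<mm>" "s \<in> S" "y = \<nu> \<oplus> ?a \<otimes> s" by (auto simp: Q_def)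
      have "s \<otimes> ?a \<in> Q (c' \<otimes> z')" using stableD(4)[OF QQ y(2) \<open>?a \<in> Q (c' \<otimes> z')\<close>] .
      moreover have "\<nu> \<in> Q (c' \<otimes> z')" using Q(3)[OF colon_m_m[OF c' z']] y by blast
      ultimately have "\<nu> \<oplus> s \<otimes> ?a \<in> Q (c' \<otimes> z')" using stableD(3)[OF QQ] by simp
      then show "y \<in> Q (c' \<otimes> z')" using y carr by (simp add: m_comm)
    qed
    \<comment> \<open>The glued ideal contains the maximal one, so they agree and lie in
      \<open>M\<close>; yet the glued ideal also contains \<open>e\<close>, which is outside
      \<open>M\<close>.\<close>
    then have "Q (c' \<otimes> z') = Q ?a" using max[OF \<open>P c' z'\<close>] by simp
    moreover have "?e \<in> Q (c' \<otimes> z')"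
    proof -
      let ?\<nu> = "(\<one> \<ominus> ?a) \<otimes> (?e \<otimes> (\<one> \<ominus> ?e)) \<ominus> ?e \<otimes> \<mu>"
      have "?\<nu> \<in> \<mm>" using stable_minus[OF stable_S_m] integral_closure_m aS eS g(2) \<mu>(1) by simp
      moreover have "?\<nu> \<oplus> (q \<oplus> \<mu>) \<otimes> ?e = ?e"
        unfolding q_def using carr(1,2,3) by algebra
      ultimately show ?thesis using *[of ?\<nu> ?e] eS by simp
    qed
    ultimately show False using eM M(2) by blast
  qed
  then obtain \<mu> t where "\<mu> \<in> \<mm>" "t \<in> S" "\<one> = \<mu> \<oplus> ?a \<otimes> t" by (auto simp: Q_def)
  then show ?thesis using cz' by blast
qed

text \<open>\<open>c z t = 1 - \<mu>\<close> lies in the local ring \<open>A\<close> and outside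
  \<open>\<mm>\<close>, so it has an inverse \<open>b\<close> already in \<open>A\<close>. Every
  \<open>y\<close> in \<open>\<mm>\<close> is then \<open>(t b (z y)) c\<close>, where
  \<open>z y\<close> is in \<open>S\<close>.\<close>

lemma m_principal: "\<exists>c\<in>carrier K. c \<noteq> \<zero> \<and> \<mm> = (\<lambda>s. s \<otimes> c) ` S"
proof -
  obtain c z t \<mu> where *: "c \<in> \<mm>" "z \<in> colon_m" "t \<in> S" "\<mu> \<in> \<mm>" "\<one> = \<mu> \<oplus> c \<otimes> z \<otimes> t"
    using exists_product_unit_mod_m by auto
  have carr: "c \<in> carrier K" "z \<in> carrier K" "t \<in> carrier K" "\<mu> \<in> carrier K"
    using * by (auto simp: colon_m_def)
  have u: "c \<otimes> z \<otimes> t = \<one> \<ominus> \<mu>"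
  proof -
    have "c \<otimes> z \<otimes> t = (\<mu> \<oplus> c \<otimes> z \<otimes> t) \<ominus> \<mu>" using carr by algebra
    then show ?thesis using *(5) by simp
  qed
  have "\<one> \<ominus> \<mu> \<notin> \<mm>"
  proof
    assume "\<one> \<ominus> \<mu> \<in> \<mm>"
    then have "(\<one> \<ominus> \<mu>) \<oplus> \<mu> \<in> \<mm>" using stableD(3)[OF m_stable] * by simp
    moreover have "(\<one> \<ominus> \<mu>) \<oplus> \<mu> = \<one>" using carr by algebra
    ultimately show False using one_notin_m by simp
  qed
  then obtain b where b: "b \<in> A" "c \<otimes> z \<otimes> t \<otimes> b = \<one>"
    unfolding u using unit_if_notin_m[of "\<one> \<ominus> \<mu>"] *(4) by (metis A_minus A_simps(2) m_A)
  have bc: "b \<in> carrier K" using b by simp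
  have "c \<noteq> \<zero>" using b bc carr by auto
  moreover have "\<mm> = (\<lambda>s. s \<otimes> c) ` S"
  proof
    show "(\<lambda>s. s \<otimes> c) ` S \<subseteq> \<mm>" using integral_closure_m *(1) by auto
    show "\<mm> \<subseteq> (\<lambda>s. s \<otimes> c) ` S"
    proof
      fix y assume y: "y \<in> \<mm>"
      have yc: "y \<in> carrier K" using y by simp
      have "y = (c \<otimes> z \<otimes> t \<otimes> b) \<otimes> y" using b yc by simp
      also have "\<dots> = (t \<otimes> b \<otimes> (z \<otimes> y)) \<otimes> c" using carr bc yc by algebra
      finally show "y \<in> (\<lambda>s. s \<otimes> c) ` S"
        using * b y by (intro image_eqI[of _ _ "t \<otimes> b \<otimes> (z \<otimes> y)"]) (simp_all add: colon_m_def)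
    qed
  qed
  ultimately show ?thesis using carr by blast
qed

end

section \<open>Ideals of one-dimensional noetherian local domains\<close>

text \<open>Zorn's lemma applies because the union of a nonempty chain of ideals in a noetherian
  ring is itself a member of the chain.\<close>

lemma (in noetherian_ring) exists_maximal_ideal_in_family:
  assumes ne: "\<F> \<noteq> {}" and F: "\<And>I. I \<in> \<F> \<Longrightarrow> ideal I R"
  shows "\<exists>M\<in>\<F>. \<forall>I\<in>\<F>. M \<subseteq> I \<longrightarrow> I = M"
proof (rule subset_Zorn_nonempty[OF ne])
  fix \<C> assume C: "\<C> \<noteq> {}" "subset.chain \<F> \<C>"
  then have "subset.chain {I. ideal I R} \<C>" using F by (auto simp: pred_on.chain_def)
  then have "\<Union>\<C> \<in> \<C>" using ideal_chain_is_trivial C(1) by blast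
  then show "\<Union>\<C> \<in> \<F>" using C(2) by (auto simp: pred_on.chain_def)
qed

locale one_dim_local_domain = R?: noetherian_domain R for R (structure) +
  fixes \<mm>
  assumes local: "local_ring R \<mm>"
    and dim: "krull_dim R = 1"
begin

lemma m_ideal: "ideal \<mm> R" and m_maximal: "maximalideal \<mm> R" and m_prime: "primeideal \<mm> R"
  using local maximalideal.axioms(1) maximalideal_prime by (auto simp: local_ring_def)

lemma m_carrier: "x \<in> \<mm> \<Longrightarrow> x \<in> carrier R"
  using ideal.Icarr[OF m_ideal] .

lemma one_notin_m: "\<one> \<notin> \<mm>"
  using maximalideal.I_notcarr[OF m_maximal] ideal.one_imp_carrier[OF m_ideal] by auto

text \<open>A non-unit generates a proper ideal; the maximum condition enlarges it to a maximal
  ideal, which locality identifies with \<open>\<mm>\<close>.\<close>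

lemma unit_if_notin_m:
  assumes a: "a \<in> carrier R" "a \<notin> \<mm>"
  shows "\<exists>b\<in>carrier R. a \<otimes> b = \<one>"
proof (rule ccontr)
  assume neg: "\<not> ?thesis"
  have "\<one> \<notin> PIdl a"
  proof
    assume "\<one> \<in> PIdl a"
    then obtain x where "x \<in> carrier R" "\<one> = x \<otimes> a" by (auto simp: cgenideal_def)
    then show False using neg a m_comm by metis
  qed
  let ?F = "{I. ideal I R \<and> a \<in> I \<and> \<one> \<notin> I}"
  have "PIdl a \<in> ?F" using \<open>\<one> \<notin> PIdl a\<close> cgenideal_ideal[OF a(1)] cgenideal_self[OF a(1)] by simp
  then have "\<exists>M\<in>?F. \<forall>I\<in>?F. M \<subseteq> I \<longrightarrow> I = M"
    by (intro exists_maximal_ideal_in_family) blast+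
  then obtain M where M: "ideal M R" "a \<in> M" "\<one> \<notin> M"
    and max: "\<And>I. ideal I R \<Longrightarrow> a \<in> I \<Longrightarrow> \<one> \<notin> I \<Longrightarrow> M \<subseteq> I \<Longrightarrow> I = M" by blast
  have "maximalideal M R"
  proof (rule maximalidealI)
    show "carrier R \<noteq> M" using M(3) by auto
    fix J assume J: "ideal J R" "M \<subseteq> J" "J \<subseteq> carrier R"
    show "J = M \<or> J = carrier R"
    proof (cases "\<one> \<in> J")
      case True
      then show ?thesis using ideal.one_imp_carrier[OF J(1)] by simp
    next
      case False
      then show ?thesis using max J M(2) by blast
    qed
  qed (rule M)
  then have "M = \<mm>" using local by (simp add: local_ring_def)
  then show False using M(2) a(2) by simp
qed

lemma prime_subset_m:
  assumes P: "primeideal P R"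
  shows "P \<subseteq> \<mm>"
proof
  fix x assume x: "x \<in> P"
  have I: "ideal P R" using P by (rule primeideal.axioms)
  have xc: "x \<in> carrier R" using ideal.Icarr[OF I x] .
  show "x \<in> \<mm>"
  proof (rule ccontr)
    assume "x \<notin> \<mm>"
    then obtain b where b: "b \<in> carrier R" "x \<otimes> b = \<one>" using unit_if_notin_m xc by auto
    then have "\<one> \<in> P" using ideal.I_r_closed[OF I x b(1)] by simp
    then show False using primeideal.I_notcarr[OF P] ideal.one_imp_carrier[OF I] by simp
  qed
qed

text \<open>A supremum equal to 1 needs a chain of positive length. Its member \<open>P 1\<close>
  properly contains another ideal, so it is nonzero, and it lies in \<open>\<mm>\<close>.\<close>

lemma m_nonzero: "\<exists>a\<in>\<mm>. a \<noteq> \<zero>"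
proof -
  let ?N = "{n. \<exists>P. (\<forall>i\<le>n. primeideal (P i) R) \<and> (\<forall>i<n. P i \<subset> P (Suc i))}"
  have "\<exists>n\<in>?N. n \<noteq> 0"
  proof (rule ccontr)
    assume "\<not> ?thesis"
    then have n0: "n = 0" if "n \<in> ?N" for n using that by blast
    have "enat n \<le> 0" if "n \<in> ?N" for n using n0[OF that] by (simp add: zero_enat_def)
    then have "(SUP n\<in>?N. enat n) \<le> 0" by (rule SUP_least)
    then show False using dim by (simp add: krull_dim_def)
  qed
  then obtain n P where n: "n \<noteq> 0" and P: "\<forall>i\<le>n. primeideal (P i) R" "\<forall>i<n. P i \<subset> P (Suc i)"
    by auto
  have P0: "primeideal (P 0) R" and P1: "primeideal (P 1) R" and lt: "P 0 \<subset> P 1" using P n by auto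
  have "\<zero> \<in> P 0" using additive_subgroup.zero_closed ideal.axioms(1) primeideal.axioms(1)[OF P0] by metis
  then obtain a where "a \<in> P 1" "a \<noteq> \<zero>" using lt by auto
  then show ?thesis using prime_subset_m[OF P1] by auto
qed

text \<open>Otherwise the zero ideal, \<open>P\<close> and \<open>\<mm>\<close> would form a chain
  of length two.\<close>

lemma no_intermediate_prime:
  assumes P: "primeideal P R" and a: "a \<in> P" "a \<noteq> \<zero>"
  shows "P = \<mm>"
proof (rule ccontr)
  assume "P \<noteq> \<mm>"
  then have lt: "P \<subset> \<mm>" using prime_subset_m[OF P] by auto
  define Q where "Q i = (if i = 0 then {\<zero>} else if i = 1 then P else \<mm>)" for i :: nat
  have "\<zero> \<in> P" using additive_subgroup.zero_closed ideal.axioms(1) primeideal.axioms(1)[OF P] by metis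
  then have "{\<zero>} \<subset> P" using a by auto
  then have "\<forall>i<2. Q i \<subset> Q (Suc i)" using lt by (auto simp: Q_def)
  moreover have "\<forall>i\<le>2. primeideal (Q i) R"
    using P m_prime zeroprimeideal by (auto simp: Q_def)
  ultimately have "enat 2 \<le> krull_dim R"
    unfolding krull_dim_def by (intro SUP_upper) auto
  then show False using dim by (simp add: one_enat_def)
qed

text \<open>An ideal maximal among those containing \<open>a\<close> and missing all powers of
  \<open>y\<close> is prime, hence equal to \<open>\<mm>\<close> by dimension one, although
  \<open>\<mm>\<close> contains \<open>y\<close>. Thus the radical of \<open>a R\<close> is
  \<open>\<mm>\<close>.\<close>

lemma power_dvd:
  assumes a: "a \<in> \<mm>" "a \<noteq> \<zero>" and y: "y \<in> \<mm>"
  shows "\<exists>n::nat. \<exists>c\<in>carrier R. y [^] n = a \<otimes> c"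
proof (rule ccontr)
  assume neg: "\<not> ?thesis"
  have ac: "a \<in> carrier R" and yc: "y \<in> carrier R" using m_carrier a y by auto
  let ?F = "{I. ideal I R \<and> a \<in> I \<and> (\<forall>n::nat. y [^] n \<notin> I)}"
  have "y [^] n \<notin> PIdl a" for n :: nat
  proof
    assume "y [^] n \<in> PIdl a"
    then obtain x where "x \<in> carrier R" "y [^] n = x \<otimes> a" by (auto simp: cgenideal_def)
    then show False using neg ac m_comm by metis
  qed
  then have "PIdl a \<in> ?F" using cgenideal_ideal[OF ac] cgenideal_self[OF ac] by simp
  then have "\<exists>M\<in>?F. \<forall>I\<in>?F. M \<subseteq> I \<longrightarrow> I = M"
    by (intro exists_maximal_ideal_in_family) blast+
  then obtain P where P': "P \<in> ?F" "\<And>I. I \<in> ?F \<Longrightarrow> P \<subseteq> I \<Longrightarrow> I = P" by meson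
  have P: "ideal P R" "a \<in> P" "\<And>n::nat. y [^] n \<notin> P" using P'(1) by simp_all
  have max: "I = P" if "ideal I R" "a \<in> I" "\<forall>n::nat. y [^] n \<notin> I" "P \<subseteq> I" for I
    using P'(2) that by simp
  interpret P: ideal P R by (rule P)
  have pow: "\<exists>n::nat. \<exists>p\<in>P. \<exists>r\<in>carrier R. y [^] n = p \<oplus> r \<otimes> u"
    if u: "u \<in> carrier R" "u \<notin> P" for u
  proof -
    let ?I = "P <+>\<^bsub>R\<^esub> PIdl u"
    have I: "ideal ?I R" using add_ideals[OF P(1) cgenideal_ideal[OF u(1)]] .
    have sub: "P \<subseteq> ?I"
    proof
      fix p assume p: "p \<in> P"
      have "p = p \<oplus> \<zero> \<otimes> u" using P.Icarr[OF p] u by simp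
      then show "p \<in> ?I" using p unfolding set_add_def' cgenideal_def by blast
    qed
    have "u = \<zero> \<oplus> \<one> \<otimes> u" using u by simp
    then have "u \<in> ?I" using P.zero_closed unfolding set_add_def' cgenideal_def by blast
    then have "?I \<noteq> P" using u by blast
    then obtain n :: nat where "y [^] n \<in> ?I" using max[OF I] sub P(2) by blast
    then show ?thesis unfolding set_add_def' cgenideal_def by blast
  qed
  have "primeideal P R"
  proof (rule primeidealI[OF P(1) is_cring])
    show "carrier R \<noteq> P" using P(3)[of 0] by auto
    fix u v assume uv: "u \<in> carrier R" "v \<in> carrier R" "u \<otimes> v \<in> P"
    show "u \<in> P \<or> v \<in> P"
    proof (rule ccontr)
      assume "\<not> ?thesis"
      then obtain n n' :: nat and p r p' r' where
        *: "p \<in> P" "r \<in> carrier R" "y [^] n = p \<oplus> r \<otimes> u"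
          "p' \<in> P" "r' \<in> carrier R" "y [^] n' = p' \<oplus> r' \<otimes> v"
        using pow uv by metis
      \<comment> \<open>Every term of the expanded product contains \<open>p\<close>,
        \<open>p'\<close> or \<open>u v\<close>, so a power of \<open>y\<close> would fall into
        \<open>P\<close>.\<close>
      have "y [^] (n + n') = (p \<oplus> r \<otimes> u) \<otimes> (p' \<oplus> r' \<otimes> v)"
        using * yc by (simp add: nat_pow_mult[symmetric])
      also have "\<dots> = (p' \<oplus> r' \<otimes> v) \<otimes> p \<oplus> (r \<otimes> u \<otimes> p' \<oplus> r \<otimes> r' \<otimes> (u \<otimes> v))"
        using P.Icarr[OF *(1)] P.Icarr[OF *(4)] *(2,5) uv by algebra
      also have "\<dots> \<in> P"
        using P.I_l_closed P.Icarr * uv by (simp add: P.a_closed)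
      finally show False using P(3) by blast
    qed
  qed
  then have "P = \<mm>" using no_intermediate_prime P(2) a(2) by blast
  then show False using P(3)[of 1] y yc by simp
qed

end

section \<open>Passage to the fraction field\<close>

locale one_dim_local_fraction_field = one_dim_local_domain R \<mm> + fraction_field R K \<iota>
  for R :: "('a, 'r) ring_scheme" (structure) and \<mm> :: "'a set"
    and K :: "('k, 's) ring_scheme" (structure) and \<iota> :: "'a \<Rightarrow> 'k"
begin

lemma \<iota>_closed [simp]: "x \<in> carrier R \<Longrightarrow> \<iota> x \<in> carrier K"
  and \<iota>_mult: "x \<in> carrier R \<Longrightarrow> y \<in> carrier R \<Longrightarrow> \<iota> (x \<otimes>\<^bsub>R\<^esub> y) = \<iota> x \<otimes>\<^bsub>K\<^esub> \<iota> y"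
  and \<iota>_add: "x \<in> carrier R \<Longrightarrow> y \<in> carrier R \<Longrightarrow> \<iota> (x \<oplus>\<^bsub>R\<^esub> y) = \<iota> x \<oplus>\<^bsub>K\<^esub> \<iota> y"
  and \<iota>_one [simp]: "\<iota> \<one>\<^bsub>R\<^esub> = \<one>\<^bsub>K\<^esub>"
  and \<iota>_zero [simp]: "\<iota> \<zero>\<^bsub>R\<^esub> = \<zero>\<^bsub>K\<^esub>"
  using ring_hom_closed[OF embedding_hom] ring_hom_mult[OF embedding_hom]
    ring_hom_add[OF embedding_hom] ring_hom_one[OF embedding_hom]
    ring_hom_zero[OF embedding_hom R.ring_axioms K.ring_axioms] by auto

lemma \<iota>_eq_iff: "x \<in> carrier R \<Longrightarrow> y \<in> carrier R \<Longrightarrow> \<iota> x = \<iota> y \<longleftrightarrow> x = y"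
  using embedding_inj by (auto simp: inj_on_def)

lemma \<iota>_pow: "x \<in> carrier R \<Longrightarrow> \<iota> (x [^]\<^bsub>R\<^esub> (n::nat)) = \<iota> x [^]\<^bsub>K\<^esub> n"
  by (induction n) (simp_all add: \<iota>_mult)

lemma denominator_R:
  assumes x: "x \<in> carrier K"
  shows "\<exists>a\<in>carrier R. \<exists>b\<in>carrier R. b \<noteq> \<zero>\<^bsub>R\<^esub> \<and> \<iota> b \<otimes>\<^bsub>K\<^esub> x = \<iota> a"
proof -
  obtain a b where ab: "a \<in> carrier R" "b \<in> carrier R" "b \<noteq> \<zero>\<^bsub>R\<^esub>" "x = \<iota> a \<otimes>\<^bsub>K\<^esub> inv\<^bsub>K\<^esub> (\<iota> b)"
    using fractions[OF x] by auto
  have "\<iota> b \<noteq> \<zero>\<^bsub>K\<^esub>" using ab \<iota>_eq_iff[of b "\<zero>\<^bsub>R\<^esub>"] by simp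
  then have i: "inv\<^bsub>K\<^esub> (\<iota> b) \<in> carrier K" "\<iota> b \<otimes>\<^bsub>K\<^esub> inv\<^bsub>K\<^esub> (\<iota> b) = \<one>\<^bsub>K\<^esub>"
    using ab(2) K.field_Units by auto
  have "\<iota> b \<otimes>\<^bsub>K\<^esub> x = \<iota> a \<otimes>\<^bsub>K\<^esub> (\<iota> b \<otimes>\<^bsub>K\<^esub> inv\<^bsub>K\<^esub> (\<iota> b))"
    unfolding ab(4) using ab(1,2) i(1) by (simp add: K.m_lcomm)
  then show ?thesis using ab i by auto
qed

lemma stable_image_ideal:
  assumes I: "K.stable (\<iota> ` carrier R) I"
  shows "ideal {r \<in> carrier R. \<iota> r \<in> I} R"
proof -
  let ?I = "{r \<in> carrier R. \<iota> r \<in> I}"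
  have mult: "x \<otimes>\<^bsub>R\<^esub> a \<in> ?I" if "a \<in> ?I" "x \<in> carrier R" for a x
    using that K.stableD(4)[OF I, of "\<iota> x" "\<iota> a"] by (simp add: \<iota>_mult)
  show ?thesis
  proof (rule idealI[OF R.ring_axioms])
    show "subgroup ?I (add_monoid R)"
    proof (rule R.add.subgroupI)
      show "?I \<noteq> {}" using K.stableD(2)[OF I] R.zero_closed \<iota>_zero by (metis (mono_tags, lifting) empty_iff mem_Collect_eq)
      fix a assume a: "a \<in> ?I"
      have "\<ominus>\<^bsub>R\<^esub> \<one>\<^bsub>R\<^esub> \<otimes>\<^bsub>R\<^esub> a \<in> ?I" by (rule mult[OF a]) simp
      then show "\<ominus>\<^bsub>R\<^esub> a \<in> ?I" using a by (simp add: R.l_minus)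
      fix b assume b: "b \<in> ?I"
      show "a \<oplus>\<^bsub>R\<^esub> b \<in> ?I" using a b K.stableD(3)[OF I] by (simp add: \<iota>_add)
    qed auto
    show "a \<otimes>\<^bsub>R\<^esub> x \<in> ?I" if "a \<in> ?I" "x \<in> carrier R" for a x
      using mult[OF that] that by (simp add: R.m_comm)
  qed (rule mult)
qed

lemma ideal_image_stable:
  assumes I: "ideal I R"
  shows "K.stable (\<iota> ` carrier R) (\<iota> ` I)"
proof -
  interpret I: ideal I R by (rule I)
  show ?thesis
  proof (rule K.stableI)
    show "\<zero>\<^bsub>K\<^esub> \<in> \<iota> ` I" using I.zero_closed \<iota>_zero by (metis imageI)
    show "x \<oplus>\<^bsub>K\<^esub> y \<in> \<iota> ` I" if "x \<in> \<iota> ` I" "y \<in> \<iota> ` I" for x y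
    proof -
      obtain a b where "a \<in> I" "b \<in> I" "x = \<iota> a" "y = \<iota> b" using \<open>x \<in> \<iota> ` I\<close> \<open>y \<in> \<iota> ` I\<close> by blast
      then show ?thesis using \<iota>_add[of a b] I.Icarr I.a_closed[of a b] by (intro image_eqI[of _ _ "a \<oplus>\<^bsub>R\<^esub> b"]) simp_all
    qed
    show "s \<otimes>\<^bsub>K\<^esub> x \<in> \<iota> ` I" if "s \<in> \<iota> ` carrier R" "x \<in> \<iota> ` I" for s x
    proof -
      obtain r a where "r \<in> carrier R" "a \<in> I" "s = \<iota> r" "x = \<iota> a"
        using \<open>s \<in> \<iota> ` carrier R\<close> \<open>x \<in> \<iota> ` I\<close> by blast
      then show ?thesis using \<iota>_mult[of r a] I.Icarr I.I_l_closed[of a r]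
        by (intro image_eqI[of _ _ "r \<otimes>\<^bsub>R\<^esub> a"]) simp_all
    qed
  qed (use I.Icarr in auto)
qed

text \<open>Preimages along the injective \<open>\<iota>\<close> turn stable subsets of the image of
  \<open>R\<close> into ideals of \<open>R\<close>, which is how \<open>acc\<close> is inherited.
  From here on all previous results hold inside \<open>K\<close>.\<close>

sublocale F: one_dim_local_fractions K "\<iota> ` carrier R" "\<iota> ` \<mm>"
proof (intro one_dim_local_fractions.intro noetherian_fractions.intro
    noetherian_fractions_axioms.intro one_dim_local_fractions_axioms.intro)
  show "field K" by (rule K.field_axioms)
  show "subring (\<iota> ` carrier R) K"
    using ring_hom_ring.img_is_subring[OF ring_hom_ringI2[OF R.ring_axioms K.ring_axioms embedding_hom]
      R.carrier_is_subring] .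
  show "\<exists>b\<in>\<iota> ` carrier R. b \<noteq> \<zero>\<^bsub>K\<^esub> \<and> b \<otimes>\<^bsub>K\<^esub> x \<in> \<iota> ` carrier R" if x: "x \<in> carrier K" for x
  proof -
    obtain a b where ab: "a \<in> carrier R" "b \<in> carrier R" "b \<noteq> \<zero>\<^bsub>R\<^esub>" "\<iota> b \<otimes>\<^bsub>K\<^esub> x = \<iota> a"
      using denominator_R[OF x] by auto
    then show ?thesis using \<iota>_eq_iff[of b "\<zero>\<^bsub>R\<^esub>"] by (intro bexI[of _ "\<iota> b"]) auto
  qed
  show "\<exists>M\<in>\<F>. \<forall>I\<in>\<F>. M \<subseteq> I \<longrightarrow> I = M"
    if ne: "\<F> \<noteq> {}" and F: "\<And>I. I \<in> \<F> \<Longrightarrow> K.stable (\<iota> ` carrier R) I \<and> I \<subseteq> \<iota> ` carrier R" for \<F>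
  proof -
    define pre where "pre I = {r \<in> carrier R. \<iota> r \<in> I}" for I
    have img: "\<iota> ` pre I = I" if "I \<in> \<F>" for I using F[OF that] by (auto simp: pre_def)
    have "\<exists>M\<in>pre ` \<F>. \<forall>I\<in>pre ` \<F>. M \<subseteq> I \<longrightarrow> I = M"
    proof (rule R.exists_maximal_ideal_in_family)
      show "ideal I R" if "I \<in> pre ` \<F>" for I
        using that F stable_image_ideal by (auto simp: pre_def)
    qed (use ne in simp)
    then obtain M where M: "M \<in> \<F>" "\<forall>I\<in>\<F>. pre M \<subseteq> pre I \<longrightarrow> pre I = pre M" by auto
    have "I = M" if "I \<in> \<F>" "M \<subseteq> I" for I
    proof -
      have "pre M \<subseteq> pre I" using that by (auto simp: pre_def)
      then have "pre I = pre M" using M that by blast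
      then show ?thesis using img M(1) that(1) by metis
    qed
    then show ?thesis using M by blast
  qed
  show "K.stable (\<iota> ` carrier R) (\<iota> ` \<mm>)" using ideal_image_stable[OF m_ideal] .
  show "\<iota> ` \<mm> \<subseteq> \<iota> ` carrier R" using m_carrier by auto
  show "\<one>\<^bsub>K\<^esub> \<notin> \<iota> ` \<mm>"
    using \<iota>_eq_iff[OF R.one_closed] m_carrier one_notin_m by auto
  show "\<exists>b\<in>\<iota> ` carrier R. a \<otimes>\<^bsub>K\<^esub> b = \<one>\<^bsub>K\<^esub>" if "a \<in> \<iota> ` carrier R" "a \<notin> \<iota> ` \<mm>" for a
  proof -
    obtain r where r: "r \<in> carrier R" "a = \<iota> r" using \<open>a \<in> \<iota> ` carrier R\<close> by blast
    then have "r \<notin> \<mm>" using \<open>a \<notin> \<iota> ` \<mm>\<close> by blast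
    then obtain b where b: "b \<in> carrier R" "r \<otimes>\<^bsub>R\<^esub> b = \<one>\<^bsub>R\<^esub>" using unit_if_notin_m r(1) by blast
    have "a \<otimes>\<^bsub>K\<^esub> \<iota> b = \<one>\<^bsub>K\<^esub>" using \<iota>_mult[OF r(1) b(1)] b(2) r(2) by simp
    then show ?thesis using b(1) by blast
  qed
  show "\<exists>a\<in>\<iota> ` \<mm>. a \<noteq> \<zero>\<^bsub>K\<^esub>"
  proof -
    obtain a where a: "a \<in> \<mm>" "a \<noteq> \<zero>\<^bsub>R\<^esub>" using m_nonzero by auto
    then show ?thesis using \<iota>_eq_iff[of a "\<zero>\<^bsub>R\<^esub>"] m_carrier by auto
  qed
  show "\<exists>n::nat. \<exists>c\<in>\<iota> ` carrier R. y [^]\<^bsub>K\<^esub> n = a \<otimes>\<^bsub>K\<^esub> c"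
    if ay: "a \<in> \<iota> ` \<mm>" "a \<noteq> \<zero>\<^bsub>K\<^esub>" "y \<in> \<iota> ` \<mm>" for a y
  proof -
    obtain r s where rs: "r \<in> \<mm>" "a = \<iota> r" "s \<in> \<mm>" "y = \<iota> s" using ay by blast
    then have "r \<noteq> \<zero>\<^bsub>R\<^esub>" using ay(2) by auto
    then obtain n :: nat and c where c: "c \<in> carrier R" "s [^]\<^bsub>R\<^esub> n = r \<otimes>\<^bsub>R\<^esub> c"
      using power_dvd rs by blast
    have "y [^]\<^bsub>K\<^esub> n = a \<otimes>\<^bsub>K\<^esub> \<iota> c"
      using rs m_carrier \<iota>_pow[of s n] \<iota>_mult[of r c] c by simp
    then show ?thesis using c(1) by blast
  qed
qed

section \<open>Module homomorphisms as multiplications in \<open>K\<close>\<close>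

definition \<kappa> :: "'k \<Rightarrow> 'a"
  where "\<kappa> = inv_into (carrier R) \<iota>"

lemma \<kappa>_\<iota> [simp]: "r \<in> carrier R \<Longrightarrow> \<kappa> (\<iota> r) = r"
  using embedding_inj by (simp add: \<kappa>_def)

lemma \<kappa>_m: "y \<in> \<iota> ` \<mm> \<Longrightarrow> \<kappa> y \<in> \<mm>" and \<iota>_\<kappa>: "y \<in> \<iota> ` \<mm> \<Longrightarrow> \<iota> (\<kappa> y) = y"
  using m_carrier by auto

lemma normalization_simps:
  "carrier (normalization R K \<iota>) = F.integral_closure"
  "x \<oplus>\<^bsub>normalization R K \<iota>\<^esub> y = x \<oplus>\<^bsub>K\<^esub> y"
  "x \<otimes>\<^bsub>normalization R K \<iota>\<^esub> y = x \<otimes>\<^bsub>K\<^esub> y"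
  "\<one>\<^bsub>normalization R K \<iota>\<^esub> = \<one>\<^bsub>K\<^esub>"
  "r \<odot>\<^bsub>normalization R K \<iota>\<^esub> x = \<iota> r \<otimes>\<^bsub>K\<^esub> x"
  by (simp_all add: normalization_def F.integral_closure_def)

lemma ideal_module_simps:
  "carrier (ideal_module R I) = I"
  "x \<oplus>\<^bsub>ideal_module R I\<^esub> y = x \<oplus>\<^bsub>R\<^esub> y"
  "r \<odot>\<^bsub>ideal_module R I\<^esub> x = r \<otimes>\<^bsub>R\<^esub> x"
  by (simp_all add: ideal_module_def)

lemma integral_closure_carrier: "s \<in> F.integral_closure \<Longrightarrow> s \<in> carrier K"
  by (simp add: F.integral_closure_def)

lemma \<iota>_cancel:
  assumes "b \<in> carrier R" "b \<noteq> \<zero>\<^bsub>R\<^esub>" "x \<in> carrier K" "y \<in> carrier K" "\<iota> b \<otimes>\<^bsub>K\<^esub> x = \<iota> b \<otimes>\<^bsub>K\<^esub> y"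
  shows "x = y"
proof -
  have "\<iota> b \<noteq> \<zero>\<^bsub>K\<^esub>" using assms \<iota>_eq_iff[of b "\<zero>\<^bsub>R\<^esub>"] by simp
  then show ?thesis using F.cancel_left[of "\<iota> b" x y] assms by simp
qed

lemma one_in_closure: "\<one>\<^bsub>K\<^esub> \<in> F.integral_closure"
  using F.subset_integral_closure \<iota>_one R.one_closed by (metis image_eqI subsetD)

text \<open>The given isomorphism is forced to send \<open>s\<close> to multiplication by
  \<open>s\<close>: if \<open>b s = a\<close> with \<open>a\<close>, \<open>b\<close> from
  \<open>R\<close>, then linearity and \<open>f 1 = 1\<close> give \<open>b (f s y0) = a y0\<close>,
  and \<open>b\<close> cancels in \<open>K\<close>.\<close>

lemma one_step_normal_imp_mult_m:
  assumes "one_step_normal R \<mm> K \<iota>" and s: "s \<in> F.integral_closure" and y: "y \<in> \<iota> ` \<mm>"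
  shows "s \<otimes>\<^bsub>K\<^esub> y \<in> \<iota> ` \<mm>"
proof -
  let ?N = "normalization R K \<iota>" and ?E = "End_algebra R (ideal_module R \<mm>)"
  obtain f where f: "f \<in> mod_hom R ?N ?E" "f \<in> ring_iso ?N ?E"
    using assms(1) by (auto simp: one_step_normal_def alg_isomorphic_def)
  have fs: "f s \<in> carrier ?E" using f(1) s by (auto simp: mod_hom_def normalization_simps)
  have smult: "f (\<iota> r \<otimes>\<^bsub>K\<^esub> x) = r \<odot>\<^bsub>?E\<^esub> f x"
    if "r \<in> carrier R" "x \<in> F.integral_closure" for r x
    using f(1) that by (auto simp: mod_hom_def normalization_simps)
  have one: "f \<one>\<^bsub>K\<^esub> = \<one>\<^bsub>?E\<^esub>" using f(2) by (auto simp: ring_iso_def ring_hom_def normalization_simps)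
  obtain y0 where y0: "y0 \<in> \<mm>" "y = \<iota> y0" using y by auto
  have fy: "f s y0 \<in> \<mm>"
    using fs y0(1) by (auto simp: End_algebra_def mod_hom_def ideal_module_simps)
  obtain a b where ab: "a \<in> carrier R" "b \<in> carrier R" "b \<noteq> \<zero>\<^bsub>R\<^esub>" "\<iota> b \<otimes>\<^bsub>K\<^esub> s = \<iota> a"
    using denominator_R[OF integral_closure_carrier[OF s]] by auto
  have "\<iota> b \<otimes>\<^bsub>K\<^esub> s = \<iota> a \<otimes>\<^bsub>K\<^esub> \<one>\<^bsub>K\<^esub>" using ab by simp
  then have "b \<odot>\<^bsub>?E\<^esub> f s = a \<odot>\<^bsub>?E\<^esub> \<one>\<^bsub>?E\<^esub>"
    using smult[OF ab(2) s] smult[OF ab(1) one_in_closure] one by simp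
  then have "(b \<odot>\<^bsub>?E\<^esub> f s) y0 = (a \<odot>\<^bsub>?E\<^esub> \<one>\<^bsub>?E\<^esub>) y0" by simp
  then have "b \<otimes>\<^bsub>R\<^esub> f s y0 = a \<otimes>\<^bsub>R\<^esub> y0"
    using y0(1) by (simp add: End_algebra_def ideal_module_simps)
  then have "\<iota> b \<otimes>\<^bsub>K\<^esub> \<iota> (f s y0) = \<iota> a \<otimes>\<^bsub>K\<^esub> y"
    using \<iota>_mult ab y0 fy m_carrier by metis
  also have "\<dots> = \<iota> b \<otimes>\<^bsub>K\<^esub> (s \<otimes>\<^bsub>K\<^esub> y)"
    unfolding ab(4)[symmetric] y0(2)
    using ab(2) integral_closure_carrier[OF s] m_carrier[OF y0(1)] by (simp add: K.m_assoc)
  finally have "\<iota> b \<otimes>\<^bsub>K\<^esub> \<iota> (f s y0) = \<iota> b \<otimes>\<^bsub>K\<^esub> (s \<otimes>\<^bsub>K\<^esub> y)" .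
  then have "\<iota> (f s y0) = s \<otimes>\<^bsub>K\<^esub> y"
    by (rule \<iota>_cancel[OF ab(2,3), rotated 2])
      (use integral_closure_carrier[OF s] m_carrier[OF y0(1)] m_carrier[OF fy] y0(2) in simp_all)
  then show ?thesis using fy by (metis imageI)
qed

text \<open>Multiplication by \<open>c\<close>, read back in \<open>R\<close> through
  \<open>\<kappa>\<close>, is the isomorphism. That sums stay in the integral closure is taken as
  the assumption \<open>add\<close>, which \<open>S_add\<close> supplies when
  \<open>S \<mm> \<subseteq> \<mm>\<close>.\<close>

lemma principal_imp_mod_isomorphic:
  assumes c: "c \<in> carrier K" "c \<noteq> \<zero>\<^bsub>K\<^esub>" and m: "\<iota> ` \<mm> = (\<lambda>s. s \<otimes>\<^bsub>K\<^esub> c) ` F.integral_closure"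
    and add: "\<And>s t. s \<in> F.integral_closure \<Longrightarrow> t \<in> F.integral_closure \<Longrightarrow> s \<oplus>\<^bsub>K\<^esub> t \<in> F.integral_closure"
  shows "mod_isomorphic R (normalization R K \<iota>) (ideal_module R \<mm>)"
proof -
  define f where "f s = \<kappa> (s \<otimes>\<^bsub>K\<^esub> c)" for s
  have mem: "s \<otimes>\<^bsub>K\<^esub> c \<in> \<iota> ` \<mm>" if "s \<in> F.integral_closure" for s using that m by blast
  have f_m: "f s \<in> \<mm>" and \<iota>f: "\<iota> (f s) = s \<otimes>\<^bsub>K\<^esub> c" if "s \<in> F.integral_closure" for s
    using \<kappa>_m[OF mem[OF that]] \<iota>_\<kappa>[OF mem[OF that]] by (simp_all add: f_def)
  note ic = integral_closure_carrier
  have A: "\<iota> r \<in> F.integral_closure" if "r \<in> carrier R" for r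
    using F.subset_integral_closure that by auto
  have "f \<in> mod_hom R (normalization R K \<iota>) (ideal_module R \<mm>)"
    unfolding mod_hom_def mem_Collect_eq normalization_simps ideal_module_simps
  proof (intro conjI ballI)
    show "f \<in> F.integral_closure \<rightarrow> \<mm>" using f_m by auto
    fix s t assume s: "s \<in> F.integral_closure" and t: "t \<in> F.integral_closure"
    have "\<iota> (f (s \<oplus>\<^bsub>K\<^esub> t)) = \<iota> (f s \<oplus>\<^bsub>R\<^esub> f t)"
      using s t c ic f_m m_carrier by (simp add: \<iota>f \<iota>_add add K.l_distr)
    then show "f (s \<oplus>\<^bsub>K\<^esub> t) = f s \<oplus>\<^bsub>R\<^esub> f t"
      using \<iota>_eq_iff f_m m_carrier s t add by simp
  next
    fix r s assume r: "r \<in> carrier R" and s: "s \<in> F.integral_closure"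
    have rs: "\<iota> r \<otimes>\<^bsub>K\<^esub> s \<in> F.integral_closure" using F.integral_closure_mult A r s by simp
    have "\<iota> (f (\<iota> r \<otimes>\<^bsub>K\<^esub> s)) = \<iota> (r \<otimes>\<^bsub>R\<^esub> f s)"
      using r s c ic f_m m_carrier rs by (simp add: \<iota>f \<iota>_mult K.m_assoc)
    then show "f (\<iota> r \<otimes>\<^bsub>K\<^esub> s) = r \<otimes>\<^bsub>R\<^esub> f s"
      using \<iota>_eq_iff f_m m_carrier s r rs by simp
  qed
  moreover have "bij_betw f F.integral_closure \<mm>"
  proof (rule bij_betwI')
    show "f s \<in> \<mm>" if "s \<in> F.integral_closure" for s using f_m that .
    show "f s = f t \<longleftrightarrow> s = t" if "s \<in> F.integral_closure" "t \<in> F.integral_closure" for s t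
    proof
      assume "f s = f t"
      then have "s \<otimes>\<^bsub>K\<^esub> c = t \<otimes>\<^bsub>K\<^esub> c" using \<iota>f that by metis
      then show "s = t" using K.m_rcancel c ic that by blast
    qed simp
    show "\<exists>s\<in>F.integral_closure. y = f s" if y: "y \<in> \<mm>" for y
    proof -
      obtain s where s: "s \<in> F.integral_closure" "\<iota> y = s \<otimes>\<^bsub>K\<^esub> c" using m y by blast
      then have "y = f s" unfolding f_def using m_carrier[OF y] by (metis \<kappa>_\<iota>)
      then show ?thesis using s by blast
    qed
  qed
  ultimately show ?thesis unfolding mod_isomorphic_def normalization_simps ideal_module_simps by blast
qed

text \<open>Clearing a denominator of \<open>s\<close> shows that the \<open>R\<close>-linear
  \<open>f\<close> is multiplication by \<open>c\<close>, the image of 1; surjectivity onto a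
  nonzero ideal excludes \<open>c = 0\<close>.\<close>

lemma mod_isomorphic_imp_principal:
  assumes "mod_isomorphic R (normalization R K \<iota>) (ideal_module R \<mm>)"
  shows "\<exists>c\<in>carrier K. c \<noteq> \<zero>\<^bsub>K\<^esub> \<and> \<iota> ` \<mm> = (\<lambda>s. s \<otimes>\<^bsub>K\<^esub> c) ` F.integral_closure"
proof -
  obtain f where f: "f \<in> mod_hom R (normalization R K \<iota>) (ideal_module R \<mm>)"
    and bij: "bij_betw f F.integral_closure \<mm>"
    using assms by (auto simp: mod_isomorphic_def normalization_simps ideal_module_simps)
  have fm: "f s \<in> \<mm>" if "s \<in> F.integral_closure" for s using bij that by (auto simp: bij_betw_def)
  have smult: "f (\<iota> r \<otimes>\<^bsub>K\<^esub> x) = r \<otimes>\<^bsub>R\<^esub> f x"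
    if "r \<in> carrier R" "x \<in> F.integral_closure" for r x
    using f that by (auto simp: mod_hom_def normalization_simps ideal_module_simps)
  define c where "c = \<iota> (f \<one>\<^bsub>K\<^esub>)"
  have f1: "f \<one>\<^bsub>K\<^esub> \<in> carrier R" using fm[OF one_in_closure] m_carrier by simp
  have c: "c \<in> carrier K" using f1 by (simp add: c_def)
  have eq: "\<iota> (f s) = s \<otimes>\<^bsub>K\<^esub> c" if s: "s \<in> F.integral_closure" for s
  proof -
    have sc: "s \<in> carrier K" using integral_closure_carrier s .
    obtain a b where ab: "a \<in> carrier R" "b \<in> carrier R" "b \<noteq> \<zero>\<^bsub>R\<^esub>" "\<iota> b \<otimes>\<^bsub>K\<^esub> s = \<iota> a"
      using denominator_R[OF sc] by auto
    have "\<iota> b \<otimes>\<^bsub>K\<^esub> s = \<iota> a \<otimes>\<^bsub>K\<^esub> \<one>\<^bsub>K\<^esub>" using ab by simp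
    then have "b \<otimes>\<^bsub>R\<^esub> f s = a \<otimes>\<^bsub>R\<^esub> f \<one>\<^bsub>K\<^esub>"
      using smult[OF ab(2) s] smult[OF ab(1) one_in_closure] by simp
    then have "\<iota> b \<otimes>\<^bsub>K\<^esub> \<iota> (f s) = \<iota> a \<otimes>\<^bsub>K\<^esub> c"
      unfolding c_def using \<iota>_mult ab f1 fm[OF s] m_carrier by metis
    also have "\<dots> = \<iota> b \<otimes>\<^bsub>K\<^esub> (s \<otimes>\<^bsub>K\<^esub> c)"
      unfolding ab(4)[symmetric] using ab(2) sc c by (simp add: K.m_assoc)
    finally have "\<iota> b \<otimes>\<^bsub>K\<^esub> \<iota> (f s) = \<iota> b \<otimes>\<^bsub>K\<^esub> (s \<otimes>\<^bsub>K\<^esub> c)" .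
    then show ?thesis
      by (rule \<iota>_cancel[OF ab(2,3), rotated 2]) (use sc c m_carrier[OF fm[OF s]] in simp_all)
  qed
  have m: "\<iota> ` \<mm> = (\<lambda>s. s \<otimes>\<^bsub>K\<^esub> c) ` F.integral_closure"
  proof -
    have "\<iota> ` \<mm> = (\<lambda>s. \<iota> (f s)) ` F.integral_closure"
      using bij by (auto simp: bij_betw_def)
    also have "\<dots> = (\<lambda>s. s \<otimes>\<^bsub>K\<^esub> c) ` F.integral_closure"
      using eq by (intro image_cong) auto
    finally show ?thesis .
  qed
  have "c \<noteq> \<zero>\<^bsub>K\<^esub>"
  proof
    assume c0: "c = \<zero>\<^bsub>K\<^esub>"
    obtain a where a: "a \<in> \<iota> ` \<mm>" "a \<noteq> \<zero>\<^bsub>K\<^esub>" using F.m_nonzero by auto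
    then show False unfolding m c0 using integral_closure_carrier by auto
  qed
  then show ?thesis using c m by blast
qed

text \<open>\<open>S\<close> acts on \<open>S c\<close> by multiplication because it is closed under
  products. The action \<open>g\<close> is faithful, as evaluation at \<open>c\<close> shows, and
  every endomorphism arises because endomorphisms of an ideal are multiplications by
  fractions.\<close>

lemma principal_imp_one_step_normal:
  assumes c: "c \<in> carrier K" "c \<noteq> \<zero>\<^bsub>K\<^esub>" and m: "\<iota> ` \<mm> = (\<lambda>s. s \<otimes>\<^bsub>K\<^esub> c) ` F.integral_closure"
  shows "one_step_normal R \<mm> K \<iota>"
proof -
  let ?N = "normalization R K \<iota>" and ?E = "End_algebra R (ideal_module R \<mm>)"
  let ?S = "F.integral_closure"
  note ic = integral_closure_carrier
  define g where "g s = (\<lambda>y\<in>\<mm>. \<kappa> (s \<otimes>\<^bsub>K\<^esub> \<iota> y))" for s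
  have mem: "s \<otimes>\<^bsub>K\<^esub> \<iota> y \<in> \<iota> ` \<mm>" if s: "s \<in> ?S" and y: "y \<in> \<mm>" for s y
  proof -
    obtain t where t: "t \<in> ?S" "\<iota> y = t \<otimes>\<^bsub>K\<^esub> c" using m y by blast
    have "s \<otimes>\<^bsub>K\<^esub> \<iota> y = (s \<otimes>\<^bsub>K\<^esub> t) \<otimes>\<^bsub>K\<^esub> c" unfolding t(2) using ic s t(1) c by (simp add: K.m_assoc)
    then show ?thesis unfolding m using F.integral_closure_mult[OF s t(1)] by blast
  qed
  have g_m: "g s y \<in> \<mm>" and \<iota>g: "\<iota> (g s y) = s \<otimes>\<^bsub>K\<^esub> \<iota> y" if "s \<in> ?S" "y \<in> \<mm>" for s y
    using \<kappa>_m[OF mem[OF that]] \<iota>_\<kappa>[OF mem[OF that]] that(2) by (simp_all add: g_def)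
  interpret m: ideal \<mm> R by (rule m_ideal)
  \<comment> \<open>Identities in \<open>\<mm>\<close> are checked after applying
    \<open>\<iota>\<close>, where \<open>g s\<close> becomes literal multiplication by
    \<open>s\<close>.\<close>
  have eqI: "x = y" if "x \<in> \<mm>" "y \<in> \<mm>" "\<iota> x = \<iota> y" for x y
    using that \<iota>_eq_iff m_carrier by blast
  have ext: "h = k" if "h \<in> extensional \<mm>" "k \<in> extensional \<mm>" "\<And>y. y \<in> \<mm> \<Longrightarrow> h y = k y" for h k :: "'a \<Rightarrow> 'a"
    using that by (rule extensionalityI)
  have E: "carrier ?E = {h \<in> \<mm> \<rightarrow> \<mm>. (\<forall>x\<in>\<mm>. \<forall>y\<in>\<mm>. h (x \<oplus>\<^bsub>R\<^esub> y) = h x \<oplus>\<^bsub>R\<^esub> h y) \<and>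
      (\<forall>r\<in>carrier R. \<forall>x\<in>\<mm>. h (r \<otimes>\<^bsub>R\<^esub> x) = r \<otimes>\<^bsub>R\<^esub> h x)} \<inter> extensional \<mm>"
    by (simp add: End_algebra_def mod_hom_def ideal_module_simps)
  have g_E: "g s \<in> carrier ?E" if s: "s \<in> ?S" for s
  proof -
    have "g s \<in> \<mm> \<rightarrow> \<mm>" "g s \<in> extensional \<mm>" using g_m s by (auto simp: g_def)
    moreover have "g s (x \<oplus>\<^bsub>R\<^esub> y) = g s x \<oplus>\<^bsub>R\<^esub> g s y" if xy: "x \<in> \<mm>" "y \<in> \<mm>" for x y
      by (rule eqI)
        (use s xy g_m ic m_carrier in \<open>simp_all add: \<iota>g \<iota>_add K.r_distr m.a_closed\<close>)
    moreover have "g s (r \<otimes>\<^bsub>R\<^esub> x) = r \<otimes>\<^bsub>R\<^esub> g s x" if rx: "r \<in> carrier R" "x \<in> \<mm>" for r x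
      by (rule eqI)
        (use s rx g_m ic m_carrier in \<open>simp_all add: \<iota>g \<iota>_mult K.m_lcomm m.I_l_closed\<close>)
    ultimately show ?thesis unfolding E by blast
  qed
  have g_ext: "g s \<in> extensional \<mm>" for s by (simp add: g_def)
  have add: "s \<oplus>\<^bsub>K\<^esub> t \<in> ?S" if s: "s \<in> ?S" and t: "t \<in> ?S" for s t
  proof (rule F.colon_subset_integral_closure)
    show "s \<oplus>\<^bsub>K\<^esub> t \<in> carrier K" using ic s t by simp
    fix y assume y: "y \<in> \<iota> ` \<mm>"
    then have "s \<otimes>\<^bsub>K\<^esub> y \<oplus>\<^bsub>K\<^esub> t \<otimes>\<^bsub>K\<^esub> y \<in> \<iota> ` \<mm>"
      using mem s t by (intro K.stableD(3)[OF F.m_stable]) auto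
    then show "(s \<oplus>\<^bsub>K\<^esub> t) \<otimes>\<^bsub>K\<^esub> y \<in> \<iota> ` \<mm>" using y ic s t m_carrier by (auto simp: K.l_distr)
  qed
  have "g \<in> mod_hom R ?N ?E"
    unfolding mod_hom_def mem_Collect_eq normalization_simps
  proof (intro conjI ballI)
    show "g \<in> ?S \<rightarrow> carrier ?E" using g_E by blast
    fix s t assume s: "s \<in> ?S" and t: "t \<in> ?S"
    have "g (s \<oplus>\<^bsub>K\<^esub> t) = (\<lambda>y\<in>\<mm>. g s y \<oplus>\<^bsub>R\<^esub> g t y)"
    proof (rule ext[OF g_ext restrict_extensional])
      fix y assume y: "y \<in> \<mm>"
      have "g (s \<oplus>\<^bsub>K\<^esub> t) y = g s y \<oplus>\<^bsub>R\<^esub> g t y"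
        by (rule eqI) (use s t y g_m ic m_carrier add in \<open>simp_all add: \<iota>g \<iota>_add K.l_distr m.a_closed\<close>)
      then show "g (s \<oplus>\<^bsub>K\<^esub> t) y = (\<lambda>y\<in>\<mm>. g s y \<oplus>\<^bsub>R\<^esub> g t y) y" using y by simp
    qed
    then show "g (s \<oplus>\<^bsub>K\<^esub> t) = g s \<oplus>\<^bsub>?E\<^esub> g t" by (simp add: End_algebra_def ideal_module_simps)
  next
    fix r s assume r: "r \<in> carrier R" and s: "s \<in> ?S"
    have rs: "\<iota> r \<otimes>\<^bsub>K\<^esub> s \<in> ?S" using F.integral_closure_mult F.subset_integral_closure r s by blast
    have "g (\<iota> r \<otimes>\<^bsub>K\<^esub> s) = (\<lambda>y\<in>\<mm>. r \<otimes>\<^bsub>R\<^esub> g s y)"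
    proof (rule ext[OF g_ext restrict_extensional])
      fix y assume y: "y \<in> \<mm>"
      have "g (\<iota> r \<otimes>\<^bsub>K\<^esub> s) y = r \<otimes>\<^bsub>R\<^esub> g s y"
        by (rule eqI) (use s r rs y g_m ic m_carrier in \<open>simp_all add: \<iota>g \<iota>_mult K.m_assoc m.I_l_closed\<close>)
      then show "g (\<iota> r \<otimes>\<^bsub>K\<^esub> s) y = (\<lambda>y\<in>\<mm>. r \<otimes>\<^bsub>R\<^esub> g s y) y" using y by simp
    qed
    then show "g (\<iota> r \<otimes>\<^bsub>K\<^esub> s) = r \<odot>\<^bsub>?E\<^esub> g s" by (simp add: End_algebra_def ideal_module_simps)
  qed
  moreover have "g (s \<otimes>\<^bsub>K\<^esub> t) = g s \<otimes>\<^bsub>?E\<^esub> g t" if s: "s \<in> ?S" and t: "t \<in> ?S" for s t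
  proof -
    have st: "s \<otimes>\<^bsub>K\<^esub> t \<in> ?S" using F.integral_closure_mult s t .
    have "g (s \<otimes>\<^bsub>K\<^esub> t) = compose \<mm> (g s) (g t)"
    proof (rule ext[OF g_ext compose_extensional])
      fix y assume y: "y \<in> \<mm>"
      have "g (s \<otimes>\<^bsub>K\<^esub> t) y = g s (g t y)"
        by (rule eqI) (use s t st y g_m ic m_carrier in \<open>simp_all add: \<iota>g K.m_assoc\<close>)
      then show "g (s \<otimes>\<^bsub>K\<^esub> t) y = compose \<mm> (g s) (g t) y" using y by (simp add: compose_def)
    qed
    then show ?thesis by (simp add: End_algebra_def ideal_module_simps)
  qed
  moreover have "g \<one>\<^bsub>K\<^esub> = \<one>\<^bsub>?E\<^esub>"
  proof -
    have "g \<one>\<^bsub>K\<^esub> = (\<lambda>y\<in>\<mm>. y)"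
    proof (rule ext[OF g_ext restrict_extensional])
      fix y assume y: "y \<in> \<mm>"
      have "g \<one>\<^bsub>K\<^esub> y = y"
        by (rule eqI) (use y g_m one_in_closure m_carrier in \<open>simp_all add: \<iota>g\<close>)
      then show "g \<one>\<^bsub>K\<^esub> y = (\<lambda>y\<in>\<mm>. y) y" using y by simp
    qed
    then show ?thesis by (simp add: End_algebra_def ideal_module_simps)
  qed
  moreover have "bij_betw g ?S (carrier ?E)"
  proof (rule bij_betwI')
    have "c \<in> \<iota> ` \<mm>"
    proof -
      have "c = \<one>\<^bsub>K\<^esub> \<otimes>\<^bsub>K\<^esub> c" using c by simp
      then show ?thesis unfolding m using one_in_closure by blast
    qed
    then obtain d where d: "d \<in> \<mm>" "c = \<iota> d" by auto
    show "g s = g t \<longleftrightarrow> s = t" if "s \<in> ?S" "t \<in> ?S" for s t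
    proof
      assume "g s = g t"
      then have "s \<otimes>\<^bsub>K\<^esub> c = t \<otimes>\<^bsub>K\<^esub> c" using \<iota>g that d by metis
      then show "s = t" using K.m_rcancel c ic that by blast
    qed simp
    show "g s \<in> carrier ?E" if "s \<in> ?S" for s using g_E that .
    show "\<exists>s\<in>?S. h = g s" if h: "h \<in> carrier ?E" for h
    proof -
      have hm: "h y \<in> \<mm>" if "y \<in> \<mm>" for y using h that unfolding E by blast
      have hmult: "h (r \<otimes>\<^bsub>R\<^esub> y) = r \<otimes>\<^bsub>R\<^esub> h y" if "r \<in> carrier R" "y \<in> \<mm>" for r y
        using h that unfolding E by blast
      have ci: "inv\<^bsub>K\<^esub> c \<in> carrier K" "inv\<^bsub>K\<^esub> c \<otimes>\<^bsub>K\<^esub> c = \<one>\<^bsub>K\<^esub>" using c K.field_Units by auto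
      \<comment> \<open>The fraction \<open>h d / d\<close>. It represents \<open>h\<close> on all
        of \<open>\<mm>\<close> because \<open>d h(y) = h(d y) = y h(d)\<close>; then
        \<open>w \<mm> \<subseteq> \<mm>\<close> makes \<open>w\<close> integral.\<close>
      define w where "w = \<iota> (h d) \<otimes>\<^bsub>K\<^esub> inv\<^bsub>K\<^esub> c"
      have hd: "\<iota> (h d) \<in> carrier K" using hm d m_carrier by simp
      have wc: "w \<in> carrier K" using hd ci by (simp add: w_def)
      have w: "w \<otimes>\<^bsub>K\<^esub> \<iota> y = \<iota> (h y)" if y: "y \<in> \<mm>" for y
      proof -
        have yc: "\<iota> y \<in> carrier K" "\<iota> (h y) \<in> carrier K" using y hm m_carrier by simp_all
        have "d \<otimes>\<^bsub>R\<^esub> h y = y \<otimes>\<^bsub>R\<^esub> h d"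
          using hmult[of d y] hmult[of y d] y d m_carrier R.m_comm by metis
        then have "c \<otimes>\<^bsub>K\<^esub> \<iota> (h y) = \<iota> y \<otimes>\<^bsub>K\<^esub> \<iota> (h d)"
          unfolding d(2) using \<iota>_mult y d hm m_carrier by metis
        have "w \<otimes>\<^bsub>K\<^esub> \<iota> y = inv\<^bsub>K\<^esub> c \<otimes>\<^bsub>K\<^esub> (\<iota> y \<otimes>\<^bsub>K\<^esub> \<iota> (h d))"
          unfolding w_def using hd ci(1) yc by (simp add: K.m_ac)
        also have "\<dots> = (inv\<^bsub>K\<^esub> c \<otimes>\<^bsub>K\<^esub> c) \<otimes>\<^bsub>K\<^esub> \<iota> (h y)"
          unfolding \<open>c \<otimes>\<^bsub>K\<^esub> \<iota> (h y) = \<iota> y \<otimes>\<^bsub>K\<^esub> \<iota> (h d)\<close>[symmetric]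
          using c(1) ci(1) yc by (simp add: K.m_assoc)
        finally show ?thesis using ci yc by simp
      qed
      have wS: "w \<in> ?S"
        by (rule F.colon_subset_integral_closure[OF wc]) (use w hm in auto)
      have "h = g w"
      proof (rule ext[OF _ g_ext])
        show "h \<in> extensional \<mm>" using h unfolding E by blast
        show "h y = g w y" if y: "y \<in> \<mm>" for y
          by (rule eqI) (use y w wS hm g_m in \<open>simp_all add: \<iota>g\<close>)
      qed
      then show ?thesis using wS by blast
    qed
  qed
  ultimately have "g \<in> mod_hom R ?N ?E \<and> g \<in> ring_iso ?N ?E"
    unfolding ring_iso_def ring_hom_def mod_hom_def mem_Collect_eq normalization_simps by simp
  then show ?thesis unfolding one_step_normal_def alg_isomorphic_def by blast
qed

lemma one_step_normal_iff:
  "one_step_normal R \<mm> K \<iota> \<longleftrightarrow> mod_isomorphic R (normalization R K \<iota>) (ideal_module R \<mm>)"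
proof
  assume osn: "one_step_normal R \<mm> K \<iota>"
  interpret G: one_step_normal_fractions K "\<iota> ` carrier R" "\<iota> ` \<mm>"
    by unfold_locales (rule one_step_normal_imp_mult_m[OF osn])
  show "mod_isomorphic R (normalization R K \<iota>) (ideal_module R \<mm>)"
    using G.m_principal principal_imp_mod_isomorphic G.S_add by blast
next
  assume "mod_isomorphic R (normalization R K \<iota>) (ideal_module R \<mm>)"
  then show "one_step_normal R \<mm> K \<iota>"
    using mod_isomorphic_imp_principal principal_imp_one_step_normal by blast
qed

end

theorem corollary4p7:
  fixes R :: "('a, 'r) ring_scheme" and \<mm> :: "'a set"
    and K :: "('k, 's) ring_scheme" and \<iota> :: "'a \<Rightarrow> 'k"
  assumes "noetherian_domain R"
    and "local_ring R \<mm>"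
    and "krull_dim R = 1"
    and "adically_complete R \<mm>"
    and "fraction_field R K \<iota>"
  shows "one_step_normal R \<mm> K \<iota> \<longleftrightarrow>
    mod_isomorphic R (normalization R K \<iota>) (ideal_module R \<mm>)"
proof -
  interpret noetherian_domain R by (rule assms(1))
  interpret fraction_field R K \<iota> by (rule assms(5))
  interpret one_dim_local_fraction_field R \<mm> K \<iota>
    by unfold_locales (rule assms(2,3))+
  show ?thesis by (rule one_step_normal_iff)
qed

end
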